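(* Let $A$ be a regular weak multiplier bialgebra over a field $k$ with left and right full comultiplication, possessing an antipode $S$. For a full left $A$-comodule $(V,\lambda,\varrho)$, also the right $A$-comodule $(V,\lambda^S,\varrho^S)$ with structure maps $$\lambda^S(v\otimes S(b)a)=((V\otimes S)\varrho^{21}(v\otimes b))(1\otimes a),\qquad \varrho^S(v\otimes aS(b))=(1\otimes a)((V\otimes S)\lambda^{21}(v\otimes b))$$ is full.
   Context: Conventions. All vector spaces are over a field $k$; $\otimes$ is $\otimes_k$; the identity map of a space $V$ is also denoted by $V$; composition is juxtaposition; $\mathsf{Lin}(V,W)$ is the space of linear maps; $\mathsf{tw}$ is the flip; $\langle\ldots\rangle$ denotes linear span. For a linear map $f:V\otimes W\to V'\otimes W'$ put $f^{21}=\mathsf{tw}f\mathsf{tw}:W\otimes V\to W'\otimes V'$ and $f^{13}=(V'\otimes\mathsf{tw})(f\otimes Z)(V\otimes\mathsf{tw}):V\otimes Z\otimes W\to V'\otimes Z\otimes W'$ for any space $Z$. An associative, possibly non-unital algebra $A$ with multiplication $\mu$ is idempotent if $\mu:A\otimes A\to A$ is surjective, and non-degenerate if each of ($ab=0\ \forall b\in A$) and ($ba=0\ \forall b\in A$) implies $a=0$. For such $A$, $\mathbb M(A)$ is the multiplier algebra of pairs $(\lambda,\varrho)$ of linear maps $A\to A$ with $a\lambda(b)=\varrho(a)b$; it is unital and contains $A$ as a two-sided ideal via $(\lambda,\varrho)a=\lambda(a)$, $a(\lambda,\varrho)=\varrho(a)$. A regular weak multiplier bialgebra is an idempotent non-degenerate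 $k$-algebra $A$ with linear maps $E_1,E_2,T_1,T_2,T_3,T_4:A\otimes A\to A\otimes A$ and $\epsilon:A\to k$ such that for all $a,b,c,d\in A$: (i) $(a\otimes b)E_1(c\otimes d)=E_2(a\otimes b)(c\otimes d)$; (ii) $E_1^2=E_1$; (iii) $(T_2\otimes A)(A\otimes T_1)=(A\otimes T_1)(T_2\otimes A)$; (iv) $(\epsilon\otimes A)T_1=\mu=(A\otimes\epsilon)T_2$; (v) $(\mu\otimes A)T_1^{13}(A\otimes T_1)=T_1(\mu\otimes A)$; (vi) $\langle T_1(a\otimes c)(b\otimes 1)\mid a,b,c\in A\rangle=\langle E_1(b\otimes c)\mid b,c\in A\rangle$ and $\langle(1\otimes c)T_2(b\otimes a)\mid a,b,c\in A\rangle=\langle E_2(b\otimes c)\mid b,c\in A\rangle$; (vii) $(E_1\otimes A)(A\otimes T_1)=(A\otimes T_1)(E_1\otimes A)$ and $(E_2\otimes A)(A\otimes T_2)=(A\otimes T_2)E_2^{13}$; (viii) $(\epsilon\otimes A)((1\otimes a)E_1(b\otimes c))=(\epsilon\otimes A)(T_1(a\otimes c)(b\otimes1))$ and $(\epsilon\otimes A)(E_2(a\otimes b)(1\otimes c))=(\epsilon\otimes A)((1\otimes b)T_2(a\otimes c))$; (ix) $(1\otimes a)T_1(c\otimes b)=T_3(c\otimes a)(1\otimes b)$ and $T_2(a\otimes c)(b\otimes1)=(a\otimes1)T_4(b\otimes c)$. Maps $A\to\mathbb M(A)$: $\overline\sqcap^L(a)b=(\epsilon\otimes A)T_2(a\otimes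 b)$, $b\overline\sqcap^L(a)=(\epsilon\otimes A)E_2(a\otimes b)$; $\overline\sqcap^R(a)b=(A\otimes\epsilon)E_1(b\otimes a)$, $b\overline\sqcap^R(a)=(A\otimes\epsilon)T_1(b\otimes a)$. The comultiplication is right full if $A=\langle(A\otimes\omega)T_1(a\otimes b)\mid a,b\in A,\ \omega\in\mathsf{Lin}(A,k)\rangle$ and left full if $A=\langle(\omega\otimes A)T_2(a\otimes b)\mid a,b\in A,\ \omega\in\mathsf{Lin}(A,k)\rangle$. Antipode. Let $G_1,G_2:A\otimes A\to A\otimes A$ be the (well-defined, idempotent) linear maps $G_1(a\otimes bc)=(a\otimes1)((\overline\sqcap^R\otimes A)\mathsf{tw}T_4(c\otimes b))$ and $G_2(ab\otimes c)=((A\otimes\overline\sqcap^L)\mathsf{tw}T_3(b\otimes a))(1\otimes c)$. $A$ possesses an antipode if there are linear maps $R_1,R_2:A\otimes A\to A\otimes A$ with $R_iT_i=G_i$, $T_iR_i=E_i$, $R_iT_iR_i=R_i$ for $i=1,2$; these are unique, and the antipode is the linear map $S:A\to\mathbb M(A)$ with $S(a)b=(\epsilon\otimes A)R_1(a\otimes b)$ and $bS(a)=(A\otimes\epsilon)R_2(b\otimes a)$. For left and right full comultiplication, $A$ is spanned by the elements $S(b)a$, and also by the elements $aS(b)$ ($a,b\in A$), and the maps $\lambda^S,\varrho^S$ in the claim are well-defined and make $V$ a right comodule. A right $A$-comodule is a vector space $V$ with linear maps $\lambda,\varrho:V\otimes A\to V\otimes A$ such that $(1\otimes a)\lambda(v\otimes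 b)=\varrho(v\otimes a)(1\otimes b)$ for all $v\in V$, $a,b\in A$, $(\lambda\otimes A)\lambda^{13}(V\otimes E_1)=(\lambda\otimes A)\lambda^{13}$ and $(\lambda\otimes A)\lambda^{13}(V\otimes T_1)=(V\otimes T_1)(\lambda\otimes A)$. It is full if $V=\langle(V\otimes\omega)\lambda(v\otimes a)\mid v\in V,a\in A,\omega\in\mathsf{Lin}(A,k)\rangle$ (equivalently, the same with $\varrho$). A left $A$-comodule is a vector space $V$ with linear maps $\lambda,\varrho:A\otimes V\to A\otimes V$ such that $(a\otimes1)\lambda(b\otimes v)=\varrho(a\otimes v)(b\otimes1)$ for all $v\in V$, $a,b\in A$, $(A\otimes\lambda)\lambda^{13}(E_1\otimes V)=(A\otimes\lambda)\lambda^{13}$ and $(A\otimes\lambda)\lambda^{13}(T_1\otimes V)=(T_1\otimes V)\lambda^{13}$. It is full if $V=\langle(\omega\otimes V)\lambda(a\otimes v)\mid v\in V,a\in A,\omega\in\mathsf{Lin}(A,k)\rangle$ (equivalently, the same with $\varrho$). *)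

theory Defs
  imports Complex_Main
begin

section \<open>Tensor products of vector spaces\<close>

text \<open>
  A vector space over the field \<open>'k\<close> is a type \<open>'v\<close> of class \<^class>\<open>ab_group_add\<close> with a scalar
  multiplication \<open>s :: 'k \<Rightarrow> 'v \<Rightarrow> 'v\<close> satisfying \<^term>\<open>vector_space s\<close>.  A tensor product cannot be
  a type constructor here, as it depends on the scalar multiplications.  It is therefore an
  arbitrary model, given by a type with a scalar multiplication and a bilinear map having the
  universal property, and what is stated holds for every choice of models.

  A definition can quantify only over targets of one fixed type.  The target \<open>'k\<close> is
  enough, because linear forms separate points: \<open>lift_ex1\<close> below is the
  universal property for arbitrary targets.
\<close>

record ('k, 'l, 'r, 't) tensor_space =
  tscale :: "'k \<Rightarrow> 't \<Rightarrow> 't"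
  tensor :: "'l \<Rightarrow> 'r \<Rightarrow> 't"  (infixl "\<otimes>\<index>" 70)

definition bilinear_map ::
  "('k::field \<Rightarrow> 'l::ab_group_add \<Rightarrow> 'l) \<Rightarrow> ('k \<Rightarrow> 'r::ab_group_add \<Rightarrow> 'r) \<Rightarrow>
   ('k \<Rightarrow> 'w::ab_group_add \<Rightarrow> 'w) \<Rightarrow> ('l \<Rightarrow> 'r \<Rightarrow> 'w) \<Rightarrow> bool" where
  "bilinear_map sL sR sW f \<longleftrightarrow>
     (\<forall>x. Vector_Spaces.linear sR sW (f x)) \<and> (\<forall>y. Vector_Spaces.linear sL sW (\<lambda>x. f x y))"

locale tensor_product =
  fixes sL :: "'k::field \<Rightarrow> 'l::ab_group_add \<Rightarrow> 'l"
    and sR :: "'k \<Rightarrow> 'r::ab_group_add \<Rightarrow> 'r"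
    and X :: "('k, 'l, 'r, 't::ab_group_add) tensor_space"
  assumes vector_space_left: "vector_space sL"
    and vector_space_right: "vector_space sR"
    and vector_space_tensor: "vector_space (tscale X)"
    and bilinear_tensor: "bilinear_map sL sR (tscale X) (tensor X)"
    and universal: "bilinear_map sL sR (*) \<beta> \<Longrightarrow>
      \<exists>!g. Vector_Spaces.linear (tscale X) (*) g \<and> (\<forall>x y. g (x \<otimes>\<^bsub>X\<^esub> y) = \<beta> x y)"

text \<open>The linear map induced by a bilinear map into the space with scalar multiplication \<open>sW\<close>.\<close>

definition lift ::
  "('k::field, 'l::ab_group_add, 'r::ab_group_add, 't::ab_group_add) tensor_space \<Rightarrow>
   ('k \<Rightarrow> 'w::ab_group_add \<Rightarrow> 'w) \<Rightarrow> ('l \<Rightarrow> 'r \<Rightarrow> 'w) \<Rightarrow> 't \<Rightarrow> 'w" where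
  "lift X sW f = (THE g. Vector_Spaces.linear (tscale X) sW g \<and> (\<forall>x y. g (x \<otimes>\<^bsub>X\<^esub> y) = f x y))"

lemma linear_functional_separates:
  fixes s :: "'k::field \<Rightarrow> 'v::ab_group_add \<Rightarrow> 'v"
  assumes "vector_space s" and "x \<notin> module.span s S"
  obtains \<phi> where "Vector_Spaces.linear s (*) \<phi>" "\<phi> x = 1" "\<forall>y \<in> S. \<phi> y = 0"
proof -
  interpret V: vector_space s by fact
  interpret P: vector_space_pair s "(*) :: 'k \<Rightarrow> 'k \<Rightarrow> 'k"
    by unfold_locales (simp_all add: algebra_simps)
  obtain B where B: "B \<subseteq> S" "V.independent B" "S \<subseteq> V.span B"
    using V.maximal_independent_subset by blast
  have xB: "x \<notin> V.span B"
    using assms(2) B(1) V.span_mono by blast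
  hence "V.independent (insert x B)"
    using B(2) by (simp add: V.independent_insert)
  from P.linear_independent_extend[OF this, of "\<lambda>z. if z = x then 1 else 0"]
  obtain \<phi> where \<phi>: "Vector_Spaces.linear s (*) \<phi>"
      "\<forall>z \<in> insert x B. \<phi> z = (if z = x then 1 else 0)"
    by blast
  have "\<forall>z \<in> B. \<phi> z = 0"
    using \<phi>(2) xB V.span_base by auto
  hence "\<forall>z \<in> V.span B. \<phi> z = 0"
    using P.linear_eq_0_on_span[OF \<phi>(1)] by blast
  hence "\<forall>y \<in> S. \<phi> y = 0" using B(3) by blast
  with \<phi> show thesis by (intro that) auto
qed

context tensor_product
begin

lemma span_tensors: "module.span (tscale X) {x \<otimes>\<^bsub>X\<^esub> y | x y. True} = UNIV"
proof (rule ccontr)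
  let ?S = "{x \<otimes>\<^bsub>X\<^esub> y | x y. True}"
  interpret L: vector_space sL by (rule vector_space_left)
  interpret R: vector_space sR by (rule vector_space_right)
  interpret T: vector_space "tscale X" by (rule vector_space_tensor)
  interpret K: vector_space "(*) :: 'k \<Rightarrow> 'k \<Rightarrow> 'k"
    by unfold_locales (simp_all add: algebra_simps)
  interpret TK: vector_space_pair "tscale X" "(*) :: 'k \<Rightarrow> 'k \<Rightarrow> 'k" ..
  interpret LK: vector_space_pair sL "(*) :: 'k \<Rightarrow> 'k \<Rightarrow> 'k" ..
  interpret RK: vector_space_pair sR "(*) :: 'k \<Rightarrow> 'k \<Rightarrow> 'k" ..
  assume "T.span ?S \<noteq> UNIV"
  then obtain t where "t \<notin> T.span ?S" by blast
  then obtain \<phi> where \<phi>: "Vector_Spaces.linear (tscale X) (*) \<phi>" "\<phi> t = 1" "\<forall>y \<in> ?S. \<phi> y = 0"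
    by (rule linear_functional_separates[OF vector_space_tensor])
  have "bilinear_map sL sR (*) (\<lambda>x y. 0)"
    unfolding bilinear_map_def using LK.linear_zero RK.linear_zero by simp
  from universal[OF this] \<phi> TK.linear_zero have "\<phi> = (\<lambda>_. 0)" by blast
  with \<phi>(2) show False by simp
qed

lemma lift_ex1:
  fixes sW :: "'k \<Rightarrow> 'w::ab_group_add \<Rightarrow> 'w"
  assumes W: "vector_space sW" and f: "bilinear_map sL sR sW f"
  shows "\<exists>!g. Vector_Spaces.linear (tscale X) sW g \<and> (\<forall>x y. g (x \<otimes>\<^bsub>X\<^esub> y) = f x y)"
proof -
  let ?S = "{x \<otimes>\<^bsub>X\<^esub> y | x y. True}"
  interpret T: vector_space "tscale X" by (rule vector_space_tensor)
  interpret W: vector_space sW by fact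
  interpret K: vector_space "(*) :: 'k \<Rightarrow> 'k \<Rightarrow> 'k"
    by unfold_locales (simp_all add: algebra_simps)
  interpret TW: vector_space_pair "tscale X" sW ..
  interpret TK: vector_space_pair "tscale X" "(*) :: 'k \<Rightarrow> 'k \<Rightarrow> 'k" ..
  obtain B where B: "B \<subseteq> ?S" "T.independent B" "?S \<subseteq> T.span B"
    using T.maximal_independent_subset by blast
  have "T.span ?S \<subseteq> T.span B"
    using B(3) T.span_minimal T.subspace_span by blast
  hence spanB: "T.span B = UNIV"
    using span_tensors by auto
  have "\<forall>b \<in> B. \<exists>p. b = fst p \<otimes>\<^bsub>X\<^esub> snd p"
    using B(1) by fastforce
  then obtain p where p: "\<forall>b \<in> B. b = fst (p b) \<otimes>\<^bsub>X\<^esub> snd (p b)"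
    by metis
  from TW.linear_independent_extend[OF B(2), of "\<lambda>b. f (fst (p b)) (snd (p b))"]
  obtain g where g: "Vector_Spaces.linear (tscale X) sW g"
      "\<forall>b \<in> B. g b = f (fst (p b)) (snd (p b))"
    by blast
  have gf: "g (x \<otimes>\<^bsub>X\<^esub> y) = f x y" for x y
  proof (rule ccontr)
    assume "g (x \<otimes>\<^bsub>X\<^esub> y) \<noteq> f x y"
    hence "g (x \<otimes>\<^bsub>X\<^esub> y) - f x y \<notin> W.span {}" by simp
    then obtain \<phi> where \<phi>: "Vector_Spaces.linear sW (*) \<phi>" "\<phi> (g (x \<otimes>\<^bsub>X\<^esub> y) - f x y) = 1"
      by (rule linear_functional_separates[OF W])
    have "bilinear_map sL sR (*) (\<lambda>x y. \<phi> (f x y))"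
      unfolding bilinear_map_def
    proof (intro conjI allI)
      show "Vector_Spaces.linear sR (*) (\<lambda>y. \<phi> (f x y))" for x
        using f Vector_Spaces.linear_compose[of sR sW "f x" "(*)" \<phi>] \<phi>(1)
        unfolding bilinear_map_def comp_def by blast
      show "Vector_Spaces.linear sL (*) (\<lambda>x. \<phi> (f x y))" for y
        using f Vector_Spaces.linear_compose[of sL sW "\<lambda>x. f x y" "(*)" \<phi>] \<phi>(1)
        unfolding bilinear_map_def comp_def by blast
    qed
    from universal[OF this] obtain h where h: "Vector_Spaces.linear (tscale X) (*) h"
        "\<forall>x y. h (x \<otimes>\<^bsub>X\<^esub> y) = \<phi> (f x y)"
      by blast
    have "\<phi> (g b) = h b" if "b \<in> B" for b
      using g(2) p h(2) that by metis
    moreover have "Vector_Spaces.linear (tscale X) (*) (\<lambda>t. \<phi> (g t))"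
      using Vector_Spaces.linear_compose[OF g(1) \<phi>(1)] by (simp add: comp_def)
    ultimately have "\<phi> (g t) = h t" for t
      using TK.linear_eq_on_span[of "\<lambda>t. \<phi> (g t)" h B t] h(1) spanB by auto
    hence "\<phi> (g (x \<otimes>\<^bsub>X\<^esub> y)) = \<phi> (f x y)" using h(2) by simp
    moreover have "\<phi> (u - v) = \<phi> u - \<phi> v" for u v
      using module_hom.diff \<phi>(1) unfolding Vector_Spaces.linear_def by blast
    ultimately show False using \<phi>(2) by simp
  qed
  have "g' = g" if g': "Vector_Spaces.linear (tscale X) sW g'" "\<forall>x y. g' (x \<otimes>\<^bsub>X\<^esub> y) = f x y" for g'
  proof
    fix t
    show "g' t = g t"
      by (rule TW.linear_eq_on_span[OF g'(1) g(1), of ?S]) (use g'(2) gf span_tensors in auto)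
  qed
  with g(1) gf show ?thesis by blast
qed

end

text \<open>
  \<open>tensor3\<close>: models of \<open>U \<otimes> V\<close>, \<open>V \<otimes> W\<close>, \<open>(U \<otimes> V) \<otimes> W\<close> and \<open>U \<otimes> (V \<otimes> W)\<close>, the latter two on the same
  space and identified along the associativity isomorphism.
\<close>

definition tensor3 ::
  "('k::field \<Rightarrow> 'u::ab_group_add \<Rightarrow> 'u) \<Rightarrow> ('k \<Rightarrow> 'v::ab_group_add \<Rightarrow> 'v) \<Rightarrow>
   ('k \<Rightarrow> 'w::ab_group_add \<Rightarrow> 'w) \<Rightarrow>
   ('k, 'u, 'v, 'uv::ab_group_add) tensor_space \<Rightarrow> ('k, 'v, 'w, 'vw::ab_group_add) tensor_space \<Rightarrow>
   ('k, 'uv, 'w, 'uvw::ab_group_add) tensor_space \<Rightarrow> ('k, 'u, 'vw, 'uvw) tensor_space \<Rightarrow> bool" where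
  "tensor3 sU sV sW UV VW UV_W U_VW \<longleftrightarrow>
     tensor_product sU sV UV \<and> tensor_product sV sW VW \<and>
     tensor_product (tscale UV) sW UV_W \<and> tensor_product sU (tscale VW) U_VW \<and>
     tscale UV_W = tscale U_VW \<and>
     (\<forall>u v w. (u \<otimes>\<^bsub>UV\<^esub> v) \<otimes>\<^bsub>UV_W\<^esub> w = u \<otimes>\<^bsub>U_VW\<^esub> (v \<otimes>\<^bsub>VW\<^esub> w))"

text \<open>\<open>tmap X Y f g\<close> is \<open>f \<otimes> g\<close>.\<close>

definition tmap ::
  "('k::field, 'l::ab_group_add, 'r::ab_group_add, 't::ab_group_add) tensor_space \<Rightarrow>
   ('k, 'm::ab_group_add, 'n::ab_group_add, 'u::ab_group_add) tensor_space \<Rightarrow>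
   ('l \<Rightarrow> 'm) \<Rightarrow> ('r \<Rightarrow> 'n) \<Rightarrow> 't \<Rightarrow> 'u" where
  "tmap X Y f g = lift X (tscale Y) (\<lambda>x y. f x \<otimes>\<^bsub>Y\<^esub> g y)"

text \<open>
  \<open>lslice sR X \<omega>\<close> is \<open>\<omega> \<otimes> R : L \<otimes> R \<rightarrow> k \<otimes> R = R\<close>, and \<open>rslice sL X \<omega>\<close> is \<open>L \<otimes> \<omega> : L \<otimes> R \<rightarrow> L\<close>.
\<close>

definition lslice ::
  "('k::field \<Rightarrow> 'r::ab_group_add \<Rightarrow> 'r) \<Rightarrow>
   ('k, 'l::ab_group_add, 'r, 't::ab_group_add) tensor_space \<Rightarrow> ('l \<Rightarrow> 'k) \<Rightarrow> 't \<Rightarrow> 'r" where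
  "lslice sR X \<omega> = lift X sR (\<lambda>x y. sR (\<omega> x) y)"

definition rslice ::
  "('k::field \<Rightarrow> 'l::ab_group_add \<Rightarrow> 'l) \<Rightarrow>
   ('k, 'l, 'r::ab_group_add, 't::ab_group_add) tensor_space \<Rightarrow> ('r \<Rightarrow> 'k) \<Rightarrow> 't \<Rightarrow> 'l" where
  "rslice sL X \<omega> = lift X sL (\<lambda>x y. sL (\<omega> y) x)"

definition flip ::
  "('k::field, 'l::ab_group_add, 'r::ab_group_add, 't::ab_group_add) tensor_space \<Rightarrow>
   ('k, 'r, 'l, 'u::ab_group_add) tensor_space \<Rightarrow> 't \<Rightarrow> 'u" where
  "flip X Y = lift X (tscale Y) (\<lambda>x y. y \<otimes>\<^bsub>Y\<^esub> x)"

text \<open>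
  \<open>leg21 VW WV f\<close> is \<open>f\<^sup>2\<^sup>1\<close>, for \<open>f : V \<otimes> W \<rightarrow> V \<otimes> W\<close>.
\<close>

definition leg21 ::
  "('k::field, 'v::ab_group_add, 'w::ab_group_add, 'vw::ab_group_add) tensor_space \<Rightarrow>
   ('k, 'w, 'v, 'wv::ab_group_add) tensor_space \<Rightarrow> ('vw \<Rightarrow> 'vw) \<Rightarrow> 'wv \<Rightarrow> 'wv" where
  "leg21 VW WV f = flip VW WV \<circ> f \<circ> flip WV VW"

text \<open>
  \<open>leg13 VW ZW V_ZW f\<close> is \<open>f\<^sup>1\<^sup>3\<close> on \<open>V \<otimes> (Z \<otimes> W)\<close>, for \<open>f : V \<otimes> W \<rightarrow> V \<otimes> W\<close>.  It is written
  without the intermediate space \<open>V \<otimes> W \<otimes> Z\<close>: if \<open>f (v \<otimes> w) = \<Sum> v' \<otimes> w'\<close> then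
  \<open>v \<otimes> z \<otimes> w\<close> is mapped to \<open>\<Sum> v' \<otimes> z \<otimes> w'\<close>.
\<close>

definition leg13 ::
  "('k::field, 'v::ab_group_add, 'w::ab_group_add, 'vw::ab_group_add) tensor_space \<Rightarrow>
   ('k, 'z::ab_group_add, 'w, 'zw::ab_group_add) tensor_space \<Rightarrow>
   ('k, 'v, 'zw, 'vzw::ab_group_add) tensor_space \<Rightarrow> ('vw \<Rightarrow> 'vw) \<Rightarrow> 'vzw \<Rightarrow> 'vzw" where
  "leg13 VW ZW V_ZW f =
     lift V_ZW (tscale V_ZW)
       (\<lambda>v. lift ZW (tscale V_ZW)
         (\<lambda>z w. lift VW (tscale V_ZW) (\<lambda>v' w'. v' \<otimes>\<^bsub>V_ZW\<^esub> (z \<otimes>\<^bsub>ZW\<^esub> w')) (f (v \<otimes>\<^bsub>VW\<^esub> w))))"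


section \<open>Multipliers\<close>

text \<open>
  A multiplier \<open>m = (\<lambda>, \<rho>)\<close> acts by \<open>m b = \<lambda> b\<close>, written \<open>lact m b\<close>, and \<open>b m = \<rho> b\<close>,
  written \<open>ract b m\<close>.
\<close>

type_synonym 'a multiplier = "('a \<Rightarrow> 'a) \<times> ('a \<Rightarrow> 'a)"

abbreviation lact :: "'a multiplier \<Rightarrow> 'a \<Rightarrow> 'a" where "lact m b \<equiv> fst m b"
abbreviation ract :: "'a \<Rightarrow> 'a multiplier \<Rightarrow> 'a" where "ract b m \<equiv> snd m b"

definition multipliers :: "('k::field \<Rightarrow> 'a::ring \<Rightarrow> 'a) \<Rightarrow> 'a multiplier set" where
  "multipliers sA = {m. Vector_Spaces.linear sA sA (fst m) \<and> Vector_Spaces.linear sA sA (snd m) \<and>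
     (\<forall>a b. a * lact m b = ract a m * b)}"

definition linear_to_multipliers ::
  "('k::field \<Rightarrow> 'a::ring \<Rightarrow> 'a) \<Rightarrow> ('a \<Rightarrow> 'a multiplier) \<Rightarrow> bool" where
  "linear_to_multipliers sA S \<longleftrightarrow> (\<forall>a. S a \<in> multipliers sA) \<and>
     (\<forall>b. Vector_Spaces.linear sA sA (\<lambda>a. lact (S a) b)) \<and>
     (\<forall>b. Vector_Spaces.linear sA sA (\<lambda>a. ract b (S a)))"


section \<open>Regular weak multiplier bialgebras\<close>

text \<open>The class \<^class>\<open>ring\<close> provides an associative multiplication, without unit.\<close>

locale idempotent_nondegenerate_algebra =
  fixes sA :: "'k::field \<Rightarrow> 'a::ring \<Rightarrow> 'a"
    and AA :: "('k, 'a, 'a, 'aa::ab_group_add) tensor_space"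
    and AA_A :: "('k, 'aa, 'a, 'aaa::ab_group_add) tensor_space"
    and A_AA :: "('k, 'a, 'aa, 'aaa) tensor_space"
  assumes tensor3_A: "tensor3 sA sA sA AA AA AA_A A_AA"
    and bilinear_mult: "bilinear_map sA sA sA (*)"
    and idempotent: "surj (lift AA sA (*))"
    and nondegenerate_right: "\<And>a :: 'a. (\<forall>b. a * b = 0) \<Longrightarrow> a = 0"
    and nondegenerate_left: "\<And>a :: 'a. (\<forall>b. b * a = 0) \<Longrightarrow> a = 0"
begin

abbreviation (input) \<mu> :: "'aa \<Rightarrow> 'a" where "\<mu> \<equiv> lift AA sA (*)"

end

locale regular_weak_multiplier_bialgebra = idempotent_nondegenerate_algebra sA AA AA_A A_AA
  for sA :: "'k::field \<Rightarrow> 'a::ring \<Rightarrow> 'a"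
    and AA :: "('k, 'a, 'a, 'aa::ab_group_add) tensor_space"
    and AA_A :: "('k, 'aa, 'a, 'aaa::ab_group_add) tensor_space"
    and A_AA :: "('k, 'a, 'aa, 'aaa) tensor_space" +
  fixes E1 E2 T1 T2 T3 T4 :: "'aa \<Rightarrow> 'aa"
    and \<epsilon> :: "'a \<Rightarrow> 'k"
  assumes linear_maps: "\<And>f. f \<in> {E1, E2, T1, T2, T3, T4} \<Longrightarrow>
      Vector_Spaces.linear (tscale AA) (tscale AA) f"
    and linear_counit: "Vector_Spaces.linear sA (*) \<epsilon>"
    \<comment> \<open>\<open>(a \<otimes> b) E1(c \<otimes> d) = E2(a \<otimes> b) (c \<otimes> d)\<close>\<close>
    and E1_E2: "tmap AA AA (\<lambda>x. a * x) (\<lambda>y. b * y) (E1 (c \<otimes>\<^bsub>AA\<^esub> d)) =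
      tmap AA AA (\<lambda>x. x * c) (\<lambda>y. y * d) (E2 (a \<otimes>\<^bsub>AA\<^esub> b))"
    and E1_idem: "E1 \<circ> E1 = E1"
    and coassociative: "tmap AA_A AA_A T2 id \<circ> tmap A_AA A_AA id T1 =
      tmap A_AA A_AA id T1 \<circ> tmap AA_A AA_A T2 id"
    and counit_T1: "lslice sA AA \<epsilon> \<circ> T1 = \<mu>"
    and counit_T2: "rslice sA AA \<epsilon> \<circ> T2 = \<mu>"
    and multiplicative: "tmap AA_A AA \<mu> id \<circ> leg13 AA AA A_AA T1 \<circ> tmap A_AA A_AA id T1 =
      T1 \<circ> tmap AA_A AA \<mu> id"
    \<comment> \<open>\<open>\<langle>T1(a \<otimes> c) (b \<otimes> 1)\<rangle> = \<langle>E1(b \<otimes> c)\<rangle>\<close> and \<open>\<langle>(1 \<otimes> c) T2(b \<otimes> a)\<rangle> = \<langle>E2(b \<otimes> c)\<rangle>\<close>\<close>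
    and range_E1: "module.span (tscale AA) {tmap AA AA (\<lambda>x. x * b) id (T1 (a \<otimes>\<^bsub>AA\<^esub> c)) | a b c. True} =
      module.span (tscale AA) {E1 (b \<otimes>\<^bsub>AA\<^esub> c) | b c. True}"
    and range_E2: "module.span (tscale AA) {tmap AA AA id (\<lambda>y. c * y) (T2 (b \<otimes>\<^bsub>AA\<^esub> a)) | a b c. True} =
      module.span (tscale AA) {E2 (b \<otimes>\<^bsub>AA\<^esub> c) | b c. True}"
    and E1_T1: "tmap AA_A AA_A E1 id \<circ> tmap A_AA A_AA id T1 =
      tmap A_AA A_AA id T1 \<circ> tmap AA_A AA_A E1 id"
    and E2_T2: "tmap AA_A AA_A E2 id \<circ> tmap A_AA A_AA id T2 =
      tmap A_AA A_AA id T2 \<circ> leg13 AA AA A_AA E2"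
    \<comment> \<open>\<open>(\<epsilon> \<otimes> A) ((1 \<otimes> a) E1(b \<otimes> c)) = (\<epsilon> \<otimes> A) (T1(a \<otimes> c) (b \<otimes> 1))\<close> and
        \<open>(\<epsilon> \<otimes> A) (E2(a \<otimes> b) (1 \<otimes> c)) = (\<epsilon> \<otimes> A) ((1 \<otimes> b) T2(a \<otimes> c))\<close>\<close>
    and counit_E1: "lslice sA AA \<epsilon> (tmap AA AA id (\<lambda>y. a * y) (E1 (b \<otimes>\<^bsub>AA\<^esub> c))) =
      lslice sA AA \<epsilon> (tmap AA AA (\<lambda>x. x * b) id (T1 (a \<otimes>\<^bsub>AA\<^esub> c)))"
    and counit_E2: "lslice sA AA \<epsilon> (tmap AA AA id (\<lambda>y. y * c) (E2 (a \<otimes>\<^bsub>AA\<^esub> b))) =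
      lslice sA AA \<epsilon> (tmap AA AA id (\<lambda>y. b * y) (T2 (a \<otimes>\<^bsub>AA\<^esub> c)))"
    \<comment> \<open>\<open>(1 \<otimes> a) T1(c \<otimes> b) = T3(c \<otimes> a) (1 \<otimes> b)\<close> and \<open>T2(a \<otimes> c) (b \<otimes> 1) = (a \<otimes> 1) T4(b \<otimes> c)\<close>\<close>
    and T1_T3: "tmap AA AA id (\<lambda>y. a * y) (T1 (c \<otimes>\<^bsub>AA\<^esub> b)) =
      tmap AA AA id (\<lambda>y. y * b) (T3 (c \<otimes>\<^bsub>AA\<^esub> a))"
    and T2_T4: "tmap AA AA (\<lambda>x. x * b) id (T2 (a \<otimes>\<^bsub>AA\<^esub> c)) =
      tmap AA AA (\<lambda>x. a * x) id (T4 (b \<otimes>\<^bsub>AA\<^esub> c))"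

text \<open>The maps \<open>\<sqinter>\<^sup>L\<close>-bar and \<open>\<sqinter>\<^sup>R\<close>-bar.\<close>

definition bar_L ::
  "('k::field \<Rightarrow> 'a::ring \<Rightarrow> 'a) \<Rightarrow> ('k, 'a, 'a, 'aa::ab_group_add) tensor_space \<Rightarrow>
   ('aa \<Rightarrow> 'aa) \<Rightarrow> ('aa \<Rightarrow> 'aa) \<Rightarrow> ('a \<Rightarrow> 'k) \<Rightarrow> 'a \<Rightarrow> 'a multiplier" where
  "bar_L sA AA E2 T2 \<epsilon> a =
     (\<lambda>b. lslice sA AA \<epsilon> (T2 (a \<otimes>\<^bsub>AA\<^esub> b)), \<lambda>b. lslice sA AA \<epsilon> (E2 (a \<otimes>\<^bsub>AA\<^esub> b)))"

definition bar_R ::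
  "('k::field \<Rightarrow> 'a::ring \<Rightarrow> 'a) \<Rightarrow> ('k, 'a, 'a, 'aa::ab_group_add) tensor_space \<Rightarrow>
   ('aa \<Rightarrow> 'aa) \<Rightarrow> ('aa \<Rightarrow> 'aa) \<Rightarrow> ('a \<Rightarrow> 'k) \<Rightarrow> 'a \<Rightarrow> 'a multiplier" where
  "bar_R sA AA E1 T1 \<epsilon> a =
     (\<lambda>b. rslice sA AA \<epsilon> (E1 (b \<otimes>\<^bsub>AA\<^esub> a)), \<lambda>b. rslice sA AA \<epsilon> (T1 (b \<otimes>\<^bsub>AA\<^esub> a)))"

definition right_full ::
  "('k::field \<Rightarrow> 'a::ring \<Rightarrow> 'a) \<Rightarrow> ('k, 'a, 'a, 'aa::ab_group_add) tensor_space \<Rightarrow>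
   ('aa \<Rightarrow> 'aa) \<Rightarrow> bool" where
  "right_full sA AA T1 \<longleftrightarrow>
     module.span sA {rslice sA AA \<omega> (T1 (a \<otimes>\<^bsub>AA\<^esub> b)) | a b \<omega>. Vector_Spaces.linear sA (*) \<omega>} = UNIV"

definition left_full ::
  "('k::field \<Rightarrow> 'a::ring \<Rightarrow> 'a) \<Rightarrow> ('k, 'a, 'a, 'aa::ab_group_add) tensor_space \<Rightarrow>
   ('aa \<Rightarrow> 'aa) \<Rightarrow> bool" where
  "left_full sA AA T2 \<longleftrightarrow>
     module.span sA {lslice sA AA \<omega> (T2 (a \<otimes>\<^bsub>AA\<^esub> b)) | a b \<omega>. Vector_Spaces.linear sA (*) \<omega>} = UNIV"


section \<open>The antipode\<close>

text \<open>
  Elements of \<open>M(A) \<otimes> A\<close> and \<open>A \<otimes> M(A)\<close> occur only after multiplication by elements of \<open>A\<close>: for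
  \<open>x \<in> A \<otimes> A\<close>, \<open>(a \<otimes> 1) ((\<sqinter> \<otimes> A) x)\<close> is the image of \<open>x\<close> under \<open>y \<otimes> z \<mapsto> a \<sqinter>(y) \<otimes> z\<close>, and likewise for
  the other three cases.  \<open>G1\<close> and \<open>G2\<close> are determined by the formulas because \<open>A\<close> is idempotent.
\<close>

definition is_G1 ::
  "('k::field \<Rightarrow> 'a::ring \<Rightarrow> 'a) \<Rightarrow> ('k, 'a, 'a, 'aa::ab_group_add) tensor_space \<Rightarrow>
   ('aa \<Rightarrow> 'aa) \<Rightarrow> ('aa \<Rightarrow> 'aa) \<Rightarrow> ('aa \<Rightarrow> 'aa) \<Rightarrow> ('a \<Rightarrow> 'k) \<Rightarrow> ('aa \<Rightarrow> 'aa) \<Rightarrow> bool" where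
  "is_G1 sA AA E1 T1 T4 \<epsilon> G1 \<longleftrightarrow> Vector_Spaces.linear (tscale AA) (tscale AA) G1 \<and>
     (\<forall>a b c. G1 (a \<otimes>\<^bsub>AA\<^esub> (b * c)) =
        tmap AA AA (\<lambda>y. ract a (bar_R sA AA E1 T1 \<epsilon> y)) id (flip AA AA (T4 (c \<otimes>\<^bsub>AA\<^esub> b))))"

definition is_G2 ::
  "('k::field \<Rightarrow> 'a::ring \<Rightarrow> 'a) \<Rightarrow> ('k, 'a, 'a, 'aa::ab_group_add) tensor_space \<Rightarrow>
   ('aa \<Rightarrow> 'aa) \<Rightarrow> ('aa \<Rightarrow> 'aa) \<Rightarrow> ('aa \<Rightarrow> 'aa) \<Rightarrow> ('a \<Rightarrow> 'k) \<Rightarrow> ('aa \<Rightarrow> 'aa) \<Rightarrow> bool" where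
  "is_G2 sA AA E2 T2 T3 \<epsilon> G2 \<longleftrightarrow> Vector_Spaces.linear (tscale AA) (tscale AA) G2 \<and>
     (\<forall>a b c. G2 ((a * b) \<otimes>\<^bsub>AA\<^esub> c) =
        tmap AA AA id (\<lambda>y. lact (bar_L sA AA E2 T2 \<epsilon> y) c) (flip AA AA (T3 (b \<otimes>\<^bsub>AA\<^esub> a))))"

definition is_antipode ::
  "('k::field \<Rightarrow> 'a::ring \<Rightarrow> 'a) \<Rightarrow> ('k, 'a, 'a, 'aa::ab_group_add) tensor_space \<Rightarrow>
   ('aa \<Rightarrow> 'aa) \<Rightarrow> ('aa \<Rightarrow> 'aa) \<Rightarrow> ('aa \<Rightarrow> 'aa) \<Rightarrow> ('aa \<Rightarrow> 'aa) \<Rightarrow> ('aa \<Rightarrow> 'aa) \<Rightarrow> ('aa \<Rightarrow> 'aa) \<Rightarrow>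
   ('a \<Rightarrow> 'k) \<Rightarrow> ('a \<Rightarrow> 'a multiplier) \<Rightarrow> bool" where
  "is_antipode sA AA E1 E2 T1 T2 T3 T4 \<epsilon> S \<longleftrightarrow>
     linear_to_multipliers sA S \<and>
     (\<exists>G1 G2 R1 R2.
        is_G1 sA AA E1 T1 T4 \<epsilon> G1 \<and> is_G2 sA AA E2 T2 T3 \<epsilon> G2 \<and>
        Vector_Spaces.linear (tscale AA) (tscale AA) R1 \<and>
        Vector_Spaces.linear (tscale AA) (tscale AA) R2 \<and>
        R1 \<circ> T1 = G1 \<and> T1 \<circ> R1 = E1 \<and> R1 \<circ> T1 \<circ> R1 = R1 \<and>
        R2 \<circ> T2 = G2 \<and> T2 \<circ> R2 = E2 \<and> R2 \<circ> T2 \<circ> R2 = R2 \<and>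
        (\<forall>a b. lact (S a) b = lslice sA AA \<epsilon> (R1 (a \<otimes>\<^bsub>AA\<^esub> b))) \<and>
        (\<forall>a b. ract b (S a) = rslice sA AA \<epsilon> (R2 (b \<otimes>\<^bsub>AA\<^esub> a))))"


section \<open>Comodules\<close>

locale right_comodule =
  fixes sV :: "'k::field \<Rightarrow> 'v::ab_group_add \<Rightarrow> 'v"
    and sA :: "'k \<Rightarrow> 'a::ring \<Rightarrow> 'a"
    and VA :: "('k, 'v, 'a, 'va::ab_group_add) tensor_space"
    and AA :: "('k, 'a, 'a, 'aa::ab_group_add) tensor_space"
    and VA_A :: "('k, 'va, 'a, 'vaa::ab_group_add) tensor_space"
    and V_AA :: "('k, 'v, 'aa, 'vaa) tensor_space"
    and E1 T1 :: "'aa \<Rightarrow> 'aa"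
    and lam rho :: "'va \<Rightarrow> 'va"
  assumes tensor3_V: "tensor3 sV sA sA VA AA VA_A V_AA"
    and linear_lam: "Vector_Spaces.linear (tscale VA) (tscale VA) lam"
    and linear_rho: "Vector_Spaces.linear (tscale VA) (tscale VA) rho"
    \<comment> \<open>\<open>(1 \<otimes> a) \<lambda>(v \<otimes> b) = \<rho>(v \<otimes> a) (1 \<otimes> b)\<close>\<close>
    and lam_rho: "tmap VA VA id (\<lambda>y. a * y) (lam (v \<otimes>\<^bsub>VA\<^esub> b)) =
      tmap VA VA id (\<lambda>y. y * b) (rho (v \<otimes>\<^bsub>VA\<^esub> a))"
    and lam_E1: "tmap VA_A VA_A lam id \<circ> leg13 VA AA V_AA lam \<circ> tmap V_AA V_AA id E1 =
      tmap VA_A VA_A lam id \<circ> leg13 VA AA V_AA lam"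
    and lam_T1: "tmap VA_A VA_A lam id \<circ> leg13 VA AA V_AA lam \<circ> tmap V_AA V_AA id T1 =
      tmap V_AA V_AA id T1 \<circ> tmap VA_A VA_A lam id"

definition right_comodule_full ::
  "('k::field \<Rightarrow> 'v::ab_group_add \<Rightarrow> 'v) \<Rightarrow> ('k \<Rightarrow> 'a::ring \<Rightarrow> 'a) \<Rightarrow>
   ('k, 'v, 'a, 'va::ab_group_add) tensor_space \<Rightarrow> ('va \<Rightarrow> 'va) \<Rightarrow> bool" where
  "right_comodule_full sV sA VA lam \<longleftrightarrow>
     module.span sV {rslice sV VA \<omega> (lam (v \<otimes>\<^bsub>VA\<^esub> a)) | v a \<omega>. Vector_Spaces.linear sA (*) \<omega>} = UNIV"

locale left_comodule =
  fixes sV :: "'k::field \<Rightarrow> 'v::ab_group_add \<Rightarrow> 'v"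
    and sA :: "'k \<Rightarrow> 'a::ring \<Rightarrow> 'a"
    and AV :: "('k, 'a, 'v, 'av::ab_group_add) tensor_space"
    and AA :: "('k, 'a, 'a, 'aa::ab_group_add) tensor_space"
    and AA_V :: "('k, 'aa, 'v, 'aav::ab_group_add) tensor_space"
    and A_AV :: "('k, 'a, 'av, 'aav) tensor_space"
    and E1 T1 :: "'aa \<Rightarrow> 'aa"
    and lam rho :: "'av \<Rightarrow> 'av"
  assumes tensor3_V: "tensor3 sA sA sV AA AV AA_V A_AV"
    and linear_lam: "Vector_Spaces.linear (tscale AV) (tscale AV) lam"
    and linear_rho: "Vector_Spaces.linear (tscale AV) (tscale AV) rho"
    \<comment> \<open>\<open>(a \<otimes> 1) \<lambda>(b \<otimes> v) = \<rho>(a \<otimes> v) (b \<otimes> 1)\<close>\<close>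
    and lam_rho: "tmap AV AV (\<lambda>x. a * x) id (lam (b \<otimes>\<^bsub>AV\<^esub> v)) =
      tmap AV AV (\<lambda>x. x * b) id (rho (a \<otimes>\<^bsub>AV\<^esub> v))"
    and lam_E1: "tmap A_AV A_AV id lam \<circ> leg13 AV AV A_AV lam \<circ> tmap AA_V AA_V E1 id =
      tmap A_AV A_AV id lam \<circ> leg13 AV AV A_AV lam"
    and lam_T1: "tmap A_AV A_AV id lam \<circ> leg13 AV AV A_AV lam \<circ> tmap AA_V AA_V T1 id =
      tmap AA_V AA_V T1 id \<circ> leg13 AV AV A_AV lam"

definition left_comodule_full ::
  "('k::field \<Rightarrow> 'v::ab_group_add \<Rightarrow> 'v) \<Rightarrow> ('k \<Rightarrow> 'a::ring \<Rightarrow> 'a) \<Rightarrow>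
   ('k, 'a, 'v, 'av::ab_group_add) tensor_space \<Rightarrow> ('av \<Rightarrow> 'av) \<Rightarrow> bool" where
  "left_comodule_full sV sA AV lam \<longleftrightarrow>
     module.span sV {lslice sV AV \<omega> (lam (a \<otimes>\<^bsub>AV\<^esub> v)) | v a \<omega>. Vector_Spaces.linear sA (*) \<omega>} = UNIV"

end

theory Submission
  imports Defs
begin

text \<open>
  Write \<open>b\<^sub>1 \<otimes> b\<^sub>2\<close> for the comultiplication and \<open>v\<^sub>-\<^sub>1 \<otimes> v\<^sub>0\<close> for the coaction, so that
  \<open>\<lambda>(b \<otimes> v) = v\<^sub>-\<^sub>1 b \<otimes> v\<^sub>0\<close>, \<open>\<rho>(b \<otimes> v) = b v\<^sub>-\<^sub>1 \<otimes> v\<^sub>0\<close>, \<open>T1(a \<otimes> b) = a\<^sub>1 \<otimes> a\<^sub>2 b\<close>,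
  \<open>T2(a \<otimes> b) = a b\<^sub>1 \<otimes> b\<^sub>2\<close> and \<open>R1(a \<otimes> b) = a\<^sub>1 \<otimes> S(a\<^sub>2) b\<close>.

  If \<open>(V, \<lambda>\<^sup>S, \<rho>\<^sup>S)\<close> is not full, there is a linear form \<open>\<theta> \<noteq> 0\<close> on \<open>V\<close> that vanishes on all slices
  of \<open>\<lambda>\<^sup>S\<close>.  As \<open>\<lambda>\<^sup>S(v \<otimes> S(b) a) = v\<^sub>0 \<otimes> S(b v\<^sub>-\<^sub>1) a\<close>, this says that the antipode kills
  all elements \<open>x = b v\<^sub>-\<^sub>1 \<theta>(v\<^sub>0)\<close>, called \<open>rho_slice b v\<close> below.  The antipode may have a kernel,
  but these elements span a coideal on one side: coassociativity of the coaction gives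
  \<open>T2(c \<otimes> x) = c b\<^sub>1 v\<^sub>-\<^sub>2 \<otimes> b\<^sub>2 v\<^sub>-\<^sub>1 \<theta>(v\<^sub>0)\<close>, whose second factor is again of the form
  considered.  So \<open>S\<close> kills the second factor (\<open>T2_rho_slice_vanishes\<close>).  In a Hopf algebra
  \<open>\<epsilon>(x) 1 = x\<^sub>1 S(x\<^sub>2) = 0\<close> would follow, so \<open>\<epsilon>\<close> would vanish on the coideal and
  \<open>x = x\<^sub>1 \<epsilon>(x\<^sub>2) = 0\<close>.

  In the weak case without unit, the role of \<open>x\<^sub>1 \<otimes> S(x\<^sub>2)\<close> is played by \<open>R1\<close>:
  \<open>(c \<otimes> 1) R1(w)\<close> is obtained from \<open>c \<otimes> E1(w)\<close> by \<open>T2 \<otimes> A\<close> followed by \<open>S\<close> acting on the last two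
  factors (\<open>R1_via_antipode\<close>).  Since the elements \<open>x\<close> are moreover closed under left
  multiplication and \<open>E1\<close> is a right module map, \<open>E1(x \<otimes> d)\<close> is again a sum of tensors with
  first factors of the same form.  Hence \<open>R1(x \<otimes> d) = 0\<close>, so
  \<open>E1(x \<otimes> d) = T1(R1(x \<otimes> d)) = 0\<close> for all \<open>d\<close>, which forces \<open>x = 0\<close> when the comultiplication is
  right full (\<open>E1_separates\<close>).  Now \<open>a (v\<^sub>-\<^sub>1 b \<theta>(v\<^sub>0)) = (a v\<^sub>-\<^sub>1 \<theta>(v\<^sub>0)) b = 0\<close>, so \<open>\<theta>\<close> vanishes
  on all slices of \<open>\<lambda>\<close>, contrary to the fullness of \<open>(V, \<lambda>, \<rho>)\<close>.
\<close>

abbreviation lin where "lin \<equiv> Vector_Spaces.linear"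

section \<open>Linear maps\<close>

lemma linI:
  assumes "vector_space s" "vector_space s'"
    and "\<And>x y. f (x + y) = f x + f y" "\<And>c x. f (s c x) = s' c (f x)"
  shows "lin s s' f"
  using assms
  by (simp add: Vector_Spaces.linear_def module_hom_def module_hom_axioms_def
      module_iff_vector_space)

lemma lin_add: "lin s s' f \<Longrightarrow> f (x + y) = f x + f y"
  and lin_scale: "lin s s' f \<Longrightarrow> f (s c x) = s' c (f x)"
  and lin_diff: "lin s s' f \<Longrightarrow> f (x - y) = f x - f y"
  and lin_zero: "lin s s' f \<Longrightarrow> f 0 = 0"
  by (auto simp: Vector_Spaces.linear_def module_hom.add module_hom.scale module_hom.diff
      module_hom.zero)

lemma lin_sum: "lin s s' f \<Longrightarrow> f (\<Sum>i\<in>I. g i) = (\<Sum>i\<in>I. f (g i))"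
  unfolding Vector_Spaces.linear_def using module_hom.sum by blast

lemma lin_space1: "lin s s' f \<Longrightarrow> vector_space s"
  and lin_space2: "lin s s' f \<Longrightarrow> vector_space s'"
  by (auto simp: Vector_Spaces.linear_def)

lemma lin_id: "vector_space s \<Longrightarrow> lin s s id"
  by (rule linI) auto

lemma lin_0: "vector_space s \<Longrightarrow> vector_space s' \<Longrightarrow> lin s s' (\<lambda>_. 0)"
  by (rule linI) (simp_all add: module.scale_zero_right module_iff_vector_space)

lemma lin_compose: "lin s s' f \<Longrightarrow> lin s' s'' g \<Longrightarrow> lin s s'' (\<lambda>x. g (f x))"
  by (rule linI) (simp_all add: lin_space1 lin_space2 lin_add lin_scale)

lemma vector_space_field: "vector_space ((*) :: 'k::field \<Rightarrow> 'k \<Rightarrow> 'k)"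
  by unfold_locales (simp_all add: algebra_simps)

lemma functionals_separate:
  assumes "vector_space s" and "\<And>\<omega>. lin s (*) \<omega> \<Longrightarrow> \<omega> x = 0"
  shows "x = 0"
proof (rule ccontr)
  assume "x \<noteq> 0"
  then have "x \<notin> module.span s {}"
    using assms(1) by (simp add: module.span_empty module_iff_vector_space)
  then obtain \<omega> where "lin s (*) \<omega>" "\<omega> x = 1"
    by (rule linear_functional_separates[OF assms(1)])
  then show False using assms(2) by fastforce
qed

lemma bilinear_mapI:
  assumes "\<And>x. lin sR sW (f x)" "\<And>y. lin sL sW (\<lambda>x. f x y)"
  shows "bilinear_map sL sR sW f"
  using assms by (simp add: bilinear_map_def)

section \<open>Maps on tensor products\<close>

context tensor_product
begin

lemma lin_lift:
  assumes "vector_space sW" "bilinear_map sL sR sW f"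
  shows "lin (tscale X) sW (lift X sW f)"
  unfolding lift_def using theI'[OF lift_ex1[OF assms]] by blast

lemma lift_tensor:
  assumes "vector_space sW" "bilinear_map sL sR sW f"
  shows "lift X sW f (x \<otimes>\<^bsub>X\<^esub> y) = f x y"
  unfolding lift_def using theI'[OF lift_ex1[OF assms]] by blast

lemma lin_tensor_left: "lin sL (tscale X) (\<lambda>x. x \<otimes>\<^bsub>X\<^esub> y)"
  and lin_tensor_right: "lin sR (tscale X) (tensor X x)"
  using bilinear_tensor by (auto simp: bilinear_map_def)

lemma tensor_induct [case_names tensor add]:
  assumes "\<And>x y. P (x \<otimes>\<^bsub>X\<^esub> y)" and "\<And>s t. P s \<Longrightarrow> P t \<Longrightarrow> P (s + t)"
  shows "P t"
proof -
  interpret T: vector_space "tscale X" by (rule vector_space_tensor)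
  have "t \<in> T.span {x \<otimes>\<^bsub>X\<^esub> y | x y. True}"
    unfolding span_tensors by simp
  then show ?thesis
  proof (induct rule: T.span_induct_alt)
    case base
    have "0 \<otimes>\<^bsub>X\<^esub> 0 = 0" using lin_zero[OF lin_tensor_left] .
    then show ?case using assms(1) by metis
  next
    case (step c t s)
    then obtain x y where "t = x \<otimes>\<^bsub>X\<^esub> y" by blast
    then have "tscale X c t = sL c x \<otimes>\<^bsub>X\<^esub> y"
      by (simp add: lin_scale[OF lin_tensor_left])
    then show ?case using assms step by metis
  qed
qed

lemma tensor_ext:
  assumes "lin (tscale X) sW f" "lin (tscale X) sW g" "\<And>x y. f (x \<otimes>\<^bsub>X\<^esub> y) = g (x \<otimes>\<^bsub>X\<^esub> y)"
  shows "f t = g t"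
  by (induct t rule: tensor_induct) (simp_all add: assms lin_add[OF assms(1)] lin_add[OF assms(2)])

lemma lin_lslice: "lin sL (*) \<omega> \<Longrightarrow> lin (tscale X) sR (lslice sR X \<omega>)"
  and lslice_tensor: "lin sL (*) \<omega> \<Longrightarrow> lslice sR X \<omega> (x \<otimes>\<^bsub>X\<^esub> y) = sR (\<omega> x) y"
proof -
  interpret R: vector_space sR by (rule vector_space_right)
  assume \<omega>: "lin sL (*) \<omega>"
  have "bilinear_map sL sR sR (\<lambda>x y. sR (\<omega> x) y)"
    by (intro bilinear_mapI linI vector_space_left vector_space_right)
      (simp_all add: lin_add[OF \<omega>] lin_scale[OF \<omega>] R.scale_right_distrib R.scale_left_distrib
        mult.commute)
  then show "lin (tscale X) sR (lslice sR X \<omega>)" "lslice sR X \<omega> (x \<otimes>\<^bsub>X\<^esub> y) = sR (\<omega> x) y"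
    by (simp_all add: lslice_def lin_lift lift_tensor vector_space_right)
qed

lemma lin_rslice: "lin sR (*) \<omega> \<Longrightarrow> lin (tscale X) sL (rslice sL X \<omega>)"
  and rslice_tensor: "lin sR (*) \<omega> \<Longrightarrow> rslice sL X \<omega> (x \<otimes>\<^bsub>X\<^esub> y) = sL (\<omega> y) x"
proof -
  interpret L: vector_space sL by (rule vector_space_left)
  assume \<omega>: "lin sR (*) \<omega>"
  have "bilinear_map sL sR sL (\<lambda>x y. sL (\<omega> y) x)"
    by (intro bilinear_mapI linI vector_space_left vector_space_right)
      (simp_all add: lin_add[OF \<omega>] lin_scale[OF \<omega>] L.scale_right_distrib L.scale_left_distrib
        mult.commute)
  then show "lin (tscale X) sL (rslice sL X \<omega>)" "rslice sL X \<omega> (x \<otimes>\<^bsub>X\<^esub> y) = sL (\<omega> y) x"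
    by (simp_all add: rslice_def lin_lift lift_tensor vector_space_left)
qed

text \<open>Both sides are \<open>(\<theta> \<otimes> \<omega>) t\<close>.\<close>

lemma rslice_lslice:
  assumes "lin sL (*) \<theta>" "lin sR (*) \<omega>"
  shows "\<theta> (rslice sL X \<omega> t) = \<omega> (lslice sR X \<theta> t)"
proof (rule tensor_ext)
  show "lin (tscale X) (*) (\<lambda>t. \<theta> (rslice sL X \<omega> t))"
    by (rule lin_compose[OF lin_rslice]) fact+
  show "lin (tscale X) (*) (\<lambda>t. \<omega> (lslice sR X \<theta> t))"
    by (rule lin_compose[OF lin_lslice]) fact+
  show "\<theta> (rslice sL X \<omega> (x \<otimes>\<^bsub>X\<^esub> y)) = \<omega> (lslice sR X \<theta> (x \<otimes>\<^bsub>X\<^esub> y))" for x y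
    by (simp add: assms rslice_tensor lslice_tensor lin_scale[OF assms(1)] lin_scale[OF assms(2)] mult.commute)
qed

text \<open>
  With respect to a basis of the right factor, \<open>t\<close> is the sum of its coordinates, which are slices, tensored
  with the basis vectors.
\<close>

lemma rslices_separate:
  assumes zero: "\<And>\<omega>. lin sR (*) \<omega> \<Longrightarrow> rslice sL X \<omega> t = 0"
  shows "t = 0"
proof -
  interpret R: vector_space sR by (rule vector_space_right)
  interpret P: vector_space_pair sR "(*) :: 'k \<Rightarrow> 'k \<Rightarrow> 'k"
    by (intro vector_space_pair.intro vector_space_right vector_space_field)
  obtain B where B: "R.independent B" "R.span B = UNIV"
    using R.maximal_independent_subset[of UNIV] by (metis top.extremum_uniqueI)
  let ?\<omega> = "\<lambda>b y. R.representation B y b"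
  have lin_\<omega>: "lin sR (*) (?\<omega> b)" for b
    using B by (intro linI vector_space_right vector_space_field)
      (simp_all add: R.representation_add R.representation_scale)
  \<comment> \<open>The finite set of basis vectors may grow, so that the sets for two summands can be merged.\<close>
  have "\<exists>F. finite F \<and> (\<forall>G. finite G \<longrightarrow> F \<subseteq> G \<longrightarrow> (\<Sum>b\<in>G. rslice sL X (?\<omega> b) t \<otimes>\<^bsub>X\<^esub> b) = t)"
  proof (induct t rule: tensor_induct)
    case (tensor x y)
    let ?F = "{b. ?\<omega> b y \<noteq> 0}"
    have "(\<Sum>b\<in>G. rslice sL X (?\<omega> b) (x \<otimes>\<^bsub>X\<^esub> y) \<otimes>\<^bsub>X\<^esub> b) = x \<otimes>\<^bsub>X\<^esub> y" if G: "finite G" "?F \<subseteq> G" for G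
    proof -
      have "y = (\<Sum>b\<in>?F. sR (?\<omega> b y) b)"
        using B by (simp add: R.sum_nonzero_representation_eq)
      also have "\<dots> = (\<Sum>b\<in>G. sR (?\<omega> b y) b)"
        using G by (intro sum.mono_neutral_left) auto
      finally have "x \<otimes>\<^bsub>X\<^esub> y = x \<otimes>\<^bsub>X\<^esub> (\<Sum>b\<in>G. sR (?\<omega> b y) b)"
        by (rule arg_cong)
      also have "\<dots> = (\<Sum>b\<in>G. x \<otimes>\<^bsub>X\<^esub> sR (?\<omega> b y) b)"
        by (rule lin_sum[OF lin_tensor_right])
      also have "\<dots> = (\<Sum>b\<in>G. rslice sL X (?\<omega> b) (x \<otimes>\<^bsub>X\<^esub> y) \<otimes>\<^bsub>X\<^esub> b)"
        by (simp add: rslice_tensor lin_\<omega> lin_scale[OF lin_tensor_left] lin_scale[OF lin_tensor_right])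
      finally show ?thesis by (rule sym)
    qed
    then show ?case
      by (intro exI[of _ ?F] conjI) (simp_all add: R.finite_representation)
  next
    case (add s t)
    obtain F where F: "finite F" "\<forall>H. finite H \<longrightarrow> F \<subseteq> H \<longrightarrow> (\<Sum>b\<in>H. rslice sL X (?\<omega> b) s \<otimes>\<^bsub>X\<^esub> b) = s"
      using add(1) by (elim exE conjE)
    obtain G where G: "finite G" "\<forall>H. finite H \<longrightarrow> G \<subseteq> H \<longrightarrow> (\<Sum>b\<in>H. rslice sL X (?\<omega> b) t \<otimes>\<^bsub>X\<^esub> b) = t"
      using add(2) by (elim exE conjE)
    from F G show ?case
      by (intro exI[of _ "F \<union> G"])
        (auto simp: lin_add[OF lin_rslice[OF lin_\<omega>]] lin_add[OF lin_tensor_left] sum.distrib)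
  qed
  then obtain F where "(\<Sum>b\<in>F. rslice sL X (?\<omega> b) t \<otimes>\<^bsub>X\<^esub> b) = t"
    by auto
  moreover have "(\<Sum>b\<in>F. rslice sL X (?\<omega> b) t \<otimes>\<^bsub>X\<^esub> b) = 0"
    by (intro sum.neutral ballI) (simp add: zero[OF lin_\<omega>] lin_zero[OF lin_tensor_left])
  ultimately show ?thesis
    by (rule trans[OF sym])
qed

lemma lslices_separate:
  assumes zero: "\<And>\<omega>. lin sL (*) \<omega> \<Longrightarrow> lslice sR X \<omega> t = 0"
  shows "t = 0"
proof (rule rslices_separate)
  fix \<omega> assume \<omega>: "lin sR (*) \<omega>"
  show "rslice sL X \<omega> t = 0"
  proof (rule functionals_separate[OF vector_space_left])
    show "\<theta> (rslice sL X \<omega> t) = 0" if \<theta>: "lin sL (*) \<theta>" for \<theta>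
      using rslice_lslice[OF \<theta> \<omega>] zero[OF \<theta>] lin_zero[OF \<omega>] by simp
  qed
qed

end

lemma
  assumes X: "tensor_product sL sR X" and Y: "tensor_product sM sN Y"
    and f: "lin sL sM f" and g: "lin sR sN g"
  shows lin_tmap: "lin (tscale X) (tscale Y) (tmap X Y f g)"
    and tmap_tensor: "tmap X Y f g (x \<otimes>\<^bsub>X\<^esub> y) = f x \<otimes>\<^bsub>Y\<^esub> g y"
proof -
  interpret X: tensor_product sL sR X by fact
  interpret Y: tensor_product sM sN Y by fact
  have "bilinear_map sL sR (tscale Y) (\<lambda>x y. f x \<otimes>\<^bsub>Y\<^esub> g y)"
    by (intro bilinear_mapI lin_compose[OF g Y.lin_tensor_right] lin_compose[OF f Y.lin_tensor_left])
  then show "lin (tscale X) (tscale Y) (tmap X Y f g)" "tmap X Y f g (x \<otimes>\<^bsub>X\<^esub> y) = f x \<otimes>\<^bsub>Y\<^esub> g y"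
    unfolding tmap_def
    by (simp_all add: X.lin_lift X.lift_tensor Y.vector_space_tensor)
qed

lemma tmap_tmap:
  assumes X: "tensor_product sL sR X" and Y: "tensor_product sM sN Y" and Z: "tensor_product sO sP Z"
    and f: "lin sL sM f" and g: "lin sR sN g" and f': "lin sM sO f'" and g': "lin sN sP g'"
  shows "tmap Y Z f' g' (tmap X Y f g t) = tmap X Z (\<lambda>x. f' (f x)) (\<lambda>y. g' (g y)) t"
proof (rule tensor_product.tensor_ext[OF X])
  show "lin (tscale X) (tscale Z) (\<lambda>t. tmap Y Z f' g' (tmap X Y f g t))"
    by (rule lin_compose[OF lin_tmap[OF X Y f g] lin_tmap[OF Y Z f' g']])
  show "lin (tscale X) (tscale Z) (tmap X Z (\<lambda>x. f' (f x)) (\<lambda>y. g' (g y)))"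
    by (rule lin_tmap[OF X Z lin_compose[OF f f'] lin_compose[OF g g']])
  show "tmap Y Z f' g' (tmap X Y f g (x \<otimes>\<^bsub>X\<^esub> y)) =
      tmap X Z (\<lambda>x. f' (f x)) (\<lambda>y. g' (g y)) (x \<otimes>\<^bsub>X\<^esub> y)" for x y
    by (simp add: tmap_tensor[OF X Y f g] tmap_tensor[OF Y Z f' g']
        tmap_tensor[OF X Z lin_compose[OF f f'] lin_compose[OF g g']])
qed

lemma rslice_tmap:
  assumes X: "tensor_product sL sR X" and Y: "tensor_product sM sN Y"
    and f: "lin sL sM f" and g: "lin sR sN g" and \<omega>: "lin sN (*) \<omega>"
  shows "rslice sM Y \<omega> (tmap X Y f g t) = f (rslice sL X (\<lambda>y. \<omega> (g y)) t)"
proof (rule tensor_product.tensor_ext[OF X])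
  have \<omega>g: "lin sR (*) (\<lambda>y. \<omega> (g y))"
    by (rule lin_compose[OF g \<omega>])
  show "lin (tscale X) sM (\<lambda>t. rslice sM Y \<omega> (tmap X Y f g t))"
    by (intro lin_compose[OF lin_tmap[OF X Y f g] tensor_product.lin_rslice[OF Y \<omega>]])
  show "lin (tscale X) sM (\<lambda>t. f (rslice sL X (\<lambda>y. \<omega> (g y)) t))"
    by (intro lin_compose[OF tensor_product.lin_rslice[OF X \<omega>g] f])
  show "rslice sM Y \<omega> (tmap X Y f g (x \<otimes>\<^bsub>X\<^esub> y)) = f (rslice sL X (\<lambda>y. \<omega> (g y)) (x \<otimes>\<^bsub>X\<^esub> y))" for x y
    by (simp add: tmap_tensor[OF X Y f g] tensor_product.rslice_tensor[OF Y \<omega>]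
        tensor_product.rslice_tensor[OF X \<omega>g] lin_scale[OF f])
qed

lemma lslice_tmap:
  assumes X: "tensor_product sL sR X" and Y: "tensor_product sM sN Y"
    and f: "lin sL sM f" and g: "lin sR sN g" and \<omega>: "lin sM (*) \<omega>"
  shows "lslice sN Y \<omega> (tmap X Y f g t) = g (lslice sR X (\<lambda>x. \<omega> (f x)) t)"
proof (rule tensor_product.tensor_ext[OF X])
  have \<omega>f: "lin sL (*) (\<lambda>x. \<omega> (f x))"
    by (rule lin_compose[OF f \<omega>])
  show "lin (tscale X) sN (\<lambda>t. lslice sN Y \<omega> (tmap X Y f g t))"
    by (intro lin_compose[OF lin_tmap[OF X Y f g] tensor_product.lin_lslice[OF Y \<omega>]])
  show "lin (tscale X) sN (\<lambda>t. g (lslice sR X (\<lambda>x. \<omega> (f x)) t))"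
    by (intro lin_compose[OF tensor_product.lin_lslice[OF X \<omega>f] g])
  show "lslice sN Y \<omega> (tmap X Y f g (x \<otimes>\<^bsub>X\<^esub> y)) = g (lslice sR X (\<lambda>x. \<omega> (f x)) (x \<otimes>\<^bsub>X\<^esub> y))" for x y
    by (simp add: tmap_tensor[OF X Y f g] tensor_product.lslice_tensor[OF Y \<omega>]
        tensor_product.lslice_tensor[OF X \<omega>f] lin_scale[OF g])
qed

text \<open>Injectivity of a family of maps on one factor carries over to the tensor product, by slicing.\<close>

lemma tmap_left_separates:
  assumes X: "tensor_product sL sR X" and Y: "tensor_product sM sR Y"
    and f: "\<And>i. lin sL sM (f i)" and inj: "\<And>x. (\<And>i. f i x = 0) \<Longrightarrow> x = 0"
    and zero: "\<And>i. tmap X Y (f i) id t = 0"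
  shows "t = 0"
proof (rule tensor_product.rslices_separate[OF X])
  fix \<omega> assume \<omega>: "lin sR (*) \<omega>"
  interpret X: tensor_product sL sR X by fact
  show "rslice sL X \<omega> t = 0"
  proof (rule inj)
    fix i
    have "f i (rslice sL X \<omega> t) = rslice sM Y \<omega> (tmap X Y (f i) id t)"
      unfolding rslice_tmap[OF X Y f[of i] lin_id[OF X.vector_space_right] \<omega>] by simp
    then show "f i (rslice sL X \<omega> t) = 0"
      by (simp add: zero lin_zero[OF tensor_product.lin_rslice[OF Y \<omega>]])
  qed
qed

lemma tmap_right_separates:
  assumes X: "tensor_product sL sR X" and Y: "tensor_product sL sN Y"
    and g: "\<And>i. lin sR sN (g i)" and inj: "\<And>x. (\<And>i. g i x = 0) \<Longrightarrow> x = 0"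
    and zero: "\<And>i. tmap X Y id (g i) t = 0"
  shows "t = 0"
proof (rule tensor_product.lslices_separate[OF X])
  fix \<omega> assume \<omega>: "lin sL (*) \<omega>"
  interpret X: tensor_product sL sR X by fact
  show "lslice sR X \<omega> t = 0"
  proof (rule inj)
    fix i
    have "g i (lslice sR X \<omega> t) = lslice sN Y \<omega> (tmap X Y id (g i) t)"
      unfolding lslice_tmap[OF X Y lin_id[OF X.vector_space_left] g[of i] \<omega>] by simp
    then show "g i (lslice sR X \<omega> t) = 0"
      by (simp add: zero lin_zero[OF tensor_product.lin_lslice[OF Y \<omega>]])
  qed
qed

lemma lin_tmap_param_left:
  assumes X: "tensor_product sL sR X" and Y: "tensor_product sM sN Y" and W: "vector_space sW"
    and f: "\<And>w. lin sL sM (f w)" and fw: "\<And>x. lin sW sM (\<lambda>w. f w x)" and g: "lin sR sN g"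
  shows "lin sW (tscale Y) (\<lambda>w. tmap X Y (f w) g t)"
proof -
  interpret X: tensor_product sL sR X by fact
  interpret Y: tensor_product sM sN Y by fact
  interpret S: vector_space "tscale Y" by (rule Y.vector_space_tensor)
  show ?thesis
  proof (rule linI[OF W Y.vector_space_tensor])
    show "tmap X Y (f (w + w')) g t = tmap X Y (f w) g t + tmap X Y (f w') g t" for w w'
    proof (induct t rule: X.tensor_induct)
      case (tensor x y)
      show ?case
        unfolding tmap_tensor[OF X Y f g] by (simp add: lin_add[OF fw] lin_add[OF Y.lin_tensor_left])
    next
      case (add s t)
      then show ?case
        unfolding lin_add[OF lin_tmap[OF X Y f g]] by (simp add: algebra_simps)
    qed
    show "tmap X Y (f (sW c w)) g t = tscale Y c (tmap X Y (f w) g t)" for c w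
    proof (induct t rule: X.tensor_induct)
      case (tensor x y)
      show ?case
        unfolding tmap_tensor[OF X Y f g] by (simp add: lin_scale[OF fw] lin_scale[OF Y.lin_tensor_left])
    next
      case (add s t)
      then show ?case
        unfolding lin_add[OF lin_tmap[OF X Y f g]] by (simp add: S.scale_right_distrib algebra_simps)
    qed
  qed
qed

lemma lin_tmap_param_right:
  assumes X: "tensor_product sL sR X" and Y: "tensor_product sM sN Y" and W: "vector_space sW"
    and f: "lin sL sM f" and g: "\<And>w. lin sR sN (g w)" and gw: "\<And>x. lin sW sN (\<lambda>w. g w x)"
  shows "lin sW (tscale Y) (\<lambda>w. tmap X Y f (g w) t)"
proof -
  interpret X: tensor_product sL sR X by fact
  interpret Y: tensor_product sM sN Y by fact
  interpret S: vector_space "tscale Y" by (rule Y.vector_space_tensor)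
  show ?thesis
  proof (rule linI[OF W Y.vector_space_tensor])
    show "tmap X Y f (g (w + w')) t = tmap X Y f (g w) t + tmap X Y f (g w') t" for w w'
    proof (induct t rule: X.tensor_induct)
      case (tensor x y)
      show ?case
        unfolding tmap_tensor[OF X Y f g] by (simp add: lin_add[OF gw] lin_add[OF Y.lin_tensor_right])
    next
      case (add s t)
      then show ?case
        unfolding lin_add[OF lin_tmap[OF X Y f g]] by (simp add: algebra_simps)
    qed
    show "tmap X Y f (g (sW c w)) t = tscale Y c (tmap X Y f (g w) t)" for c w
    proof (induct t rule: X.tensor_induct)
      case (tensor x y)
      show ?case
        unfolding tmap_tensor[OF X Y f g] by (simp add: lin_scale[OF gw] lin_scale[OF Y.lin_tensor_right])
    next
      case (add s t)
      then show ?case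
        unfolding lin_add[OF lin_tmap[OF X Y f g]] by (simp add: S.scale_right_distrib algebra_simps)
    qed
  qed
qed

lemma flip_tensor:
  assumes X: "tensor_product sL sR X" and Y: "tensor_product sR sL Y"
  shows "flip X Y (x \<otimes>\<^bsub>X\<^esub> y) = y \<otimes>\<^bsub>Y\<^esub> x"
    and lin_flip: "lin (tscale X) (tscale Y) (flip X Y)"
proof -
  interpret X: tensor_product sL sR X by fact
  interpret Y: tensor_product sR sL Y by fact
  have "bilinear_map sL sR (tscale Y) (\<lambda>x y. y \<otimes>\<^bsub>Y\<^esub> x)"
    by (intro bilinear_mapI Y.lin_tensor_left Y.lin_tensor_right)
  then show "flip X Y (x \<otimes>\<^bsub>X\<^esub> y) = y \<otimes>\<^bsub>Y\<^esub> x" "lin (tscale X) (tscale Y) (flip X Y)"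
    unfolding flip_def by (simp_all add: X.lin_lift X.lift_tensor Y.vector_space_tensor)
qed

lemma
  assumes VW: "tensor_product sV sW VW" and ZW: "tensor_product sZ sW ZW"
    and V_ZW: "tensor_product sV (tscale ZW) V_ZW" and f: "lin (tscale VW) (tscale VW) f"
  shows lin_leg13: "lin (tscale V_ZW) (tscale V_ZW) (leg13 VW ZW V_ZW f)"
    and leg13_tensor: "leg13 VW ZW V_ZW f (v \<otimes>\<^bsub>V_ZW\<^esub> (z \<otimes>\<^bsub>ZW\<^esub> w)) =
      tmap VW V_ZW id (\<lambda>w'. z \<otimes>\<^bsub>ZW\<^esub> w') (f (v \<otimes>\<^bsub>VW\<^esub> w))"
proof -
  interpret VW: tensor_product sV sW VW by fact
  interpret ZW: tensor_product sZ sW ZW by fact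
  interpret V_ZW: tensor_product sV "tscale ZW" V_ZW by fact
  interpret S: vector_space "tscale V_ZW" by (rule V_ZW.vector_space_tensor)
  note sp = VW.vector_space_left VW.vector_space_right ZW.vector_space_left V_ZW.vector_space_tensor
    ZW.vector_space_tensor
  define h where "h v z w = tmap VW V_ZW id (\<lambda>w'. z \<otimes>\<^bsub>ZW\<^esub> w') (f (v \<otimes>\<^bsub>VW\<^esub> w))" for v z w
  have tm: "lin (tscale VW) (tscale V_ZW) (tmap VW V_ZW id (\<lambda>w'. z \<otimes>\<^bsub>ZW\<^esub> w'))" for z
    by (intro lin_tmap[OF VW V_ZW] lin_id sp ZW.lin_tensor_right)
  have hw: "lin sW (tscale V_ZW) (h v z)" for v z
    unfolding h_def by (rule lin_compose[OF lin_compose[OF VW.lin_tensor_right f] tm])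
  have hv: "lin sV (tscale V_ZW) (\<lambda>v. h v z w)" for z w
    unfolding h_def by (rule lin_compose[OF lin_compose[OF VW.lin_tensor_left f] tm])
  have hz: "lin sZ (tscale V_ZW) (\<lambda>z. h v z w)" for v w
    unfolding h_def
    by (intro lin_tmap_param_right[OF VW V_ZW] lin_id sp ZW.lin_tensor_right ZW.lin_tensor_left)
  have b1: "bilinear_map sZ sW (tscale V_ZW) (h v)" for v
    by (intro bilinear_mapI hw hz)
  have b2: "bilinear_map sV (tscale ZW) (tscale V_ZW) (\<lambda>v. lift ZW (tscale V_ZW) (h v))"
  proof (rule bilinear_mapI)
    show "lin (tscale ZW) (tscale V_ZW) (lift ZW (tscale V_ZW) (h v))" for v
      by (intro ZW.lin_lift sp b1)
    show "lin sV (tscale V_ZW) (\<lambda>v. lift ZW (tscale V_ZW) (h v) t)" for t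
    proof (rule linI)
      show "lift ZW (tscale V_ZW) (h (v + v')) t =
          lift ZW (tscale V_ZW) (h v) t + lift ZW (tscale V_ZW) (h v') t" for v v'
      proof (induct t rule: ZW.tensor_induct)
        case (tensor x y)
        show ?case unfolding ZW.lift_tensor[OF sp(4) b1] by (rule lin_add[OF hv])
      next
        case (add s t)
        then show ?case
          unfolding lin_add[OF ZW.lin_lift[OF sp(4) b1]] by (simp add: S.scale_right_distrib algebra_simps)
      qed
      show "lift ZW (tscale V_ZW) (h (sV c v)) t = tscale V_ZW c (lift ZW (tscale V_ZW) (h v) t)" for c v
      proof (induct t rule: ZW.tensor_induct)
        case (tensor x y)
        show ?case unfolding ZW.lift_tensor[OF sp(4) b1] by (rule lin_scale[OF hv])
      next
        case (add s t)
        then show ?case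
          unfolding lin_add[OF ZW.lin_lift[OF sp(4) b1]] by (simp add: S.scale_right_distrib algebra_simps)
      qed
    qed (fact sp)+
  qed
  have eq: "leg13 VW ZW V_ZW f = lift V_ZW (tscale V_ZW) (\<lambda>v. lift ZW (tscale V_ZW) (h v))"
    unfolding leg13_def h_def tmap_def by simp
  show "lin (tscale V_ZW) (tscale V_ZW) (leg13 VW ZW V_ZW f)"
    unfolding eq by (intro V_ZW.lin_lift sp b2)
  show "leg13 VW ZW V_ZW f (v \<otimes>\<^bsub>V_ZW\<^esub> (z \<otimes>\<^bsub>ZW\<^esub> w)) =
      tmap VW V_ZW id (\<lambda>w'. z \<otimes>\<^bsub>ZW\<^esub> w') (f (v \<otimes>\<^bsub>VW\<^esub> w))"
    unfolding eq by (simp add: V_ZW.lift_tensor[OF sp(4) b2] ZW.lift_tensor[OF sp(4) b1] h_def)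
qed

text \<open>
  On \<open>U \<otimes> V \<otimes> W\<close>, maps that respect one bracketing have to be evaluated at tensors that respect
  the other one; the two lemmas \<open>tmap_assoc_right\<close> and \<open>tmap_assoc_left\<close> reduce this to maps on two
  factors.
\<close>

locale associative_tensors =
  fixes sU :: "'k::field \<Rightarrow> 'u::ab_group_add \<Rightarrow> 'u"
    and sV :: "'k \<Rightarrow> 'v::ab_group_add \<Rightarrow> 'v"
    and sW :: "'k \<Rightarrow> 'w::ab_group_add \<Rightarrow> 'w"
    and UV :: "('k, 'u, 'v, 'uv::ab_group_add) tensor_space"
    and VW :: "('k, 'v, 'w, 'vw::ab_group_add) tensor_space"
    and UV_W :: "('k, 'uv, 'w, 'uvw::ab_group_add) tensor_space"
    and U_VW :: "('k, 'u, 'vw, 'uvw) tensor_space"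
  assumes tensor3: "tensor3 sU sV sW UV VW UV_W U_VW"
begin

lemma UV: "tensor_product sU sV UV" and VW: "tensor_product sV sW VW"
  and UV_W: "tensor_product (tscale UV) sW UV_W" and U_VW: "tensor_product sU (tscale VW) U_VW"
  and tscale_eq: "tscale UV_W = tscale U_VW"
  and assoc: "(u \<otimes>\<^bsub>UV\<^esub> v) \<otimes>\<^bsub>UV_W\<^esub> w = u \<otimes>\<^bsub>U_VW\<^esub> (v \<otimes>\<^bsub>VW\<^esub> w)"
  using tensor3 by (simp_all add: tensor3_def)

lemma tensor3_ext:
  assumes f: "lin (tscale U_VW) sX f" and g: "lin (tscale U_VW) sX g"
    and eq: "\<And>u v w. f (u \<otimes>\<^bsub>U_VW\<^esub> (v \<otimes>\<^bsub>VW\<^esub> w)) = g (u \<otimes>\<^bsub>U_VW\<^esub> (v \<otimes>\<^bsub>VW\<^esub> w))"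
  shows "f t = g t"
proof (rule tensor_product.tensor_ext[OF U_VW f g])
  fix u s
  show "f (u \<otimes>\<^bsub>U_VW\<^esub> s) = g (u \<otimes>\<^bsub>U_VW\<^esub> s)"
    by (rule tensor_product.tensor_ext[OF VW lin_compose[OF tensor_product.lin_tensor_right[OF U_VW] f]
          lin_compose[OF tensor_product.lin_tensor_right[OF U_VW] g] eq])
qed

lemma tmap_assoc_right:
  assumes Y: "tensor_product sM sN Y" and f: "lin sU sM f" and h: "lin (tscale VW) sN h"
  shows "tmap U_VW Y f h (t \<otimes>\<^bsub>UV_W\<^esub> w) = tmap UV Y f (\<lambda>v. h (v \<otimes>\<^bsub>VW\<^esub> w)) t"
proof (rule tensor_product.tensor_ext[OF UV])
  have h': "lin sV sN (\<lambda>v. h (v \<otimes>\<^bsub>VW\<^esub> w))"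
    by (rule lin_compose[OF tensor_product.lin_tensor_left[OF VW] h])
  show "lin (tscale UV) (tscale Y) (\<lambda>t. tmap U_VW Y f h (t \<otimes>\<^bsub>UV_W\<^esub> w))"
    by (rule lin_compose[OF tensor_product.lin_tensor_left[OF UV_W, unfolded tscale_eq]
          lin_tmap[OF U_VW Y f h]])
  show "lin (tscale UV) (tscale Y) (tmap UV Y f (\<lambda>v. h (v \<otimes>\<^bsub>VW\<^esub> w)))"
    by (rule lin_tmap[OF UV Y f h'])
  show "tmap U_VW Y f h ((u \<otimes>\<^bsub>UV\<^esub> v) \<otimes>\<^bsub>UV_W\<^esub> w) =
      tmap UV Y f (\<lambda>v. h (v \<otimes>\<^bsub>VW\<^esub> w)) (u \<otimes>\<^bsub>UV\<^esub> v)" for u v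
    unfolding assoc tmap_tensor[OF U_VW Y f h] tmap_tensor[OF UV Y f h'] by (rule refl)
qed

lemma tmap_assoc_left:
  assumes Y: "tensor_product sM sN Y" and h: "lin (tscale UV) sM h" and g: "lin sW sN g"
  shows "tmap UV_W Y h g (u \<otimes>\<^bsub>U_VW\<^esub> t) = tmap VW Y (\<lambda>v. h (u \<otimes>\<^bsub>UV\<^esub> v)) g t"
proof (rule tensor_product.tensor_ext[OF VW])
  have h': "lin sV sM (\<lambda>v. h (u \<otimes>\<^bsub>UV\<^esub> v))"
    by (rule lin_compose[OF tensor_product.lin_tensor_right[OF UV] h])
  show "lin (tscale VW) (tscale Y) (\<lambda>t. tmap UV_W Y h g (u \<otimes>\<^bsub>U_VW\<^esub> t))"
    by (rule lin_compose[OF tensor_product.lin_tensor_right[OF U_VW, folded tscale_eq]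
          lin_tmap[OF UV_W Y h g]])
  show "lin (tscale VW) (tscale Y) (tmap VW Y (\<lambda>v. h (u \<otimes>\<^bsub>UV\<^esub> v)) g)"
    by (rule lin_tmap[OF VW Y h' g])
  show "tmap UV_W Y h g (u \<otimes>\<^bsub>U_VW\<^esub> (v \<otimes>\<^bsub>VW\<^esub> w)) =
      tmap VW Y (\<lambda>v. h (u \<otimes>\<^bsub>UV\<^esub> v)) g (v \<otimes>\<^bsub>VW\<^esub> w)" for v w
    unfolding assoc[symmetric] tmap_tensor[OF UV_W Y h g] tmap_tensor[OF VW Y h' g] by (rule refl)
qed

end

section \<open>The multiplication of \<open>A \<otimes> A\<close>\<close>

context idempotent_nondegenerate_algebra
begin

sublocale A3: associative_tensors sA sA sA AA AA AA_A A_AA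
  by (unfold_locales) (rule tensor3_A)

sublocale AA: tensor_product sA sA AA
  by (rule A3.UV)

sublocale AA_A: tensor_product "tscale AA" sA AA_A
  by (rule A3.UV_W)

sublocale A_AA: tensor_product sA "tscale AA" A_AA
  by (rule A3.U_VW)

lemma lin_mult_left [simp]: "lin sA sA ((*) c)"
  and lin_mult_right [simp]: "lin sA sA (\<lambda>x. x * c)"
  using bilinear_mult by (simp_all add: bilinear_map_def)

lemma lin_id_A [simp]: "lin sA sA id" "lin sA sA (\<lambda>x. x)"
  using lin_id[OF AA.vector_space_left] by (simp_all add: id_def)

lemma lin_id_AA [simp]: "lin (tscale AA) (tscale AA) id" "lin (tscale AA) (tscale AA) (\<lambda>x. x)"
  using lin_id[OF AA.vector_space_tensor] by (simp_all add: id_def)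

lemmas lin_tensor_AA [simp] = AA.lin_tensor_left AA.lin_tensor_right

lemma lin_mu [simp]: "lin (tscale AA) sA \<mu>"
  and mu_tensor [simp]: "\<mu> (x \<otimes>\<^bsub>AA\<^esub> y) = x * y"
  by (simp_all add: AA.lin_lift AA.lift_tensor AA.vector_space_left bilinear_mult)

lemma linear_eq_on_products:
  assumes f: "lin sA sW f" and g: "lin sA sW g" and eq: "\<And>a b. f (a * b) = g (a * b)"
  shows "f x = g x"
proof -
  obtain t where x: "x = \<mu> t"
    using idempotent by (meson surjD)
  have "f (\<mu> t) = g (\<mu> t)"
    by (rule AA.tensor_ext[OF lin_compose[OF lin_mu f] lin_compose[OF lin_mu g]]) (simp add: eq)
  then show ?thesis by (simp add: x)
qed

lemma lin_tmap_AA [simp]: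
    "lin sA sA f \<Longrightarrow> lin sA sA g \<Longrightarrow> lin (tscale AA) (tscale AA) (tmap AA AA f g)"
  and tmap_AA_tensor [simp]:
    "lin sA sA f \<Longrightarrow> lin sA sA g \<Longrightarrow> tmap AA AA f g (x \<otimes>\<^bsub>AA\<^esub> y) = f x \<otimes>\<^bsub>AA\<^esub> g y"
  and tmap_AA_tmap_AA:
    "lin sA sA f \<Longrightarrow> lin sA sA g \<Longrightarrow> lin sA sA f' \<Longrightarrow> lin sA sA g' \<Longrightarrow>
      tmap AA AA f' g' (tmap AA AA f g t) = tmap AA AA (\<lambda>x. f' (f x)) (\<lambda>y. g' (g y)) t"
  by (simp_all add: lin_tmap[OF AA.tensor_product_axioms AA.tensor_product_axioms]
      tmap_tensor[OF AA.tensor_product_axioms AA.tensor_product_axioms]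
      tmap_tmap[OF AA.tensor_product_axioms AA.tensor_product_axioms AA.tensor_product_axioms])

definition tmult :: "'aa \<Rightarrow> 'aa \<Rightarrow> 'aa"  (infixl "\<bullet>" 70) where
  "u \<bullet> z = lift AA (tscale AA) (\<lambda>a b. tmap AA AA ((*) a) ((*) b) z) u"

lemma lin_tmult_left [simp]: "lin (tscale AA) (tscale AA) (\<lambda>u. u \<bullet> z)"
  and tmult_tensor_left: "(a \<otimes>\<^bsub>AA\<^esub> b) \<bullet> z = tmap AA AA ((*) a) ((*) b) z"
proof -
  have "bilinear_map sA sA (tscale AA) (\<lambda>a b. tmap AA AA ((*) a) ((*) b) z)"
    by (intro bilinear_mapI lin_tmap_param_left[OF AA.tensor_product_axioms AA.tensor_product_axioms]
        lin_tmap_param_right[OF AA.tensor_product_axioms AA.tensor_product_axioms]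
        AA.vector_space_left lin_mult_left lin_mult_right)
  then show "lin (tscale AA) (tscale AA) (\<lambda>u. u \<bullet> z)"
      "(a \<otimes>\<^bsub>AA\<^esub> b) \<bullet> z = tmap AA AA ((*) a) ((*) b) z"
    unfolding tmult_def by (simp_all add: AA.lin_lift AA.lift_tensor AA.vector_space_tensor)
qed

lemma tmult_tensor_right: "u \<bullet> (p \<otimes>\<^bsub>AA\<^esub> q) = tmap AA AA (\<lambda>x. x * p) (\<lambda>y. y * q) u"
  by (rule AA.tensor_ext[OF lin_tmult_left]) (simp_all add: tmult_tensor_left)

lemma lin_tmult_right [simp]: "lin (tscale AA) (tscale AA) ((\<bullet>) u)"
proof (intro linI AA.vector_space_tensor)
  show "u \<bullet> (s + t) = u \<bullet> s + u \<bullet> t" for s t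
    by (induct u rule: AA.tensor_induct)
      (simp_all add: tmult_tensor_left lin_add[OF lin_tmap_AA] lin_add[OF lin_tmult_left])
  interpret S: vector_space "tscale AA" by (rule AA.vector_space_tensor)
  show "u \<bullet> tscale AA c t = tscale AA c (u \<bullet> t)" for c t
    by (induct u rule: AA.tensor_induct)
      (simp_all add: tmult_tensor_left lin_scale[OF lin_tmap_AA] lin_add[OF lin_tmult_left]
        S.scale_right_distrib)
qed

lemma tmult_tmap_left:
  assumes f: "lin sA sA f" and g: "lin sA sA g"
    and fm: "\<And>x y. f (x * y) = f x * y" and gm: "\<And>x y. g (x * y) = g x * y"
  shows "tmap AA AA f g u \<bullet> z = tmap AA AA f g (u \<bullet> z)"
proof (rule AA.tensor_ext[of _ "\<lambda>u. tmap AA AA f g u \<bullet> z" "\<lambda>u. tmap AA AA f g (u \<bullet> z)"])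
  show "tmap AA AA f g (x \<otimes>\<^bsub>AA\<^esub> y) \<bullet> z = tmap AA AA f g ((x \<otimes>\<^bsub>AA\<^esub> y) \<bullet> z)" for x y
    by (simp add: f g tmult_tensor_left tmap_AA_tmap_AA fm gm)
qed (rule lin_compose[OF lin_tmap_AA[OF f g] lin_tmult_left]
    lin_compose[OF lin_tmult_left lin_tmap_AA[OF f g]])+

lemma tmult_tmap_right:
  assumes f: "lin sA sA f" and g: "lin sA sA g"
    and fm: "\<And>x y. f (x * y) = x * f y" and gm: "\<And>x y. g (x * y) = x * g y"
  shows "u \<bullet> tmap AA AA f g z = tmap AA AA f g (u \<bullet> z)"
proof (rule AA.tensor_ext[of _ "\<lambda>u. u \<bullet> tmap AA AA f g z" "\<lambda>u. tmap AA AA f g (u \<bullet> z)"])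
  show "(x \<otimes>\<^bsub>AA\<^esub> y) \<bullet> tmap AA AA f g z = tmap AA AA f g ((x \<otimes>\<^bsub>AA\<^esub> y) \<bullet> z)" for x y
    by (simp add: f g tmult_tensor_left tmap_AA_tmap_AA fm gm)
qed (rule lin_tmult_left lin_compose[OF lin_tmult_left lin_tmap_AA[OF f g]])+

lemma mult_left_separates:
  assumes X: "tensor_product sA sR X" and zero: "\<And>a. tmap X X ((*) a) id t = 0"
  shows "t = 0"
  by (rule tmap_left_separates[OF X X lin_mult_left nondegenerate_left zero]) auto

lemma mult_right_separates:
  assumes X: "tensor_product sA sR X" and zero: "\<And>a. tmap X X (\<lambda>x. x * a) id t = 0"
  shows "t = 0"
  by (rule tmap_left_separates[OF X X lin_mult_right nondegenerate_right zero]) auto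

lemma mult_left_separates_right:
  assumes "\<And>b. tmap AA AA id ((*) b) t = 0"
  shows "t = 0"
  by (rule tmap_right_separates[OF AA.tensor_product_axioms AA.tensor_product_axioms
        lin_mult_left nondegenerate_left assms]) auto

lemma mult_right_separates_right:
  assumes "\<And>b. tmap AA AA id (\<lambda>x. x * b) t = 0"
  shows "t = 0"
  by (rule tmap_right_separates[OF AA.tensor_product_axioms AA.tensor_product_axioms
        lin_mult_right nondegenerate_right assms]) auto

text \<open>
  Elements of \<open>A \<otimes> A\<close> are compared through their products with simple tensors: \<open>A \<otimes> A\<close> inherits
  non-degeneracy from \<open>A\<close>, one factor at a time.
\<close>

lemma tmult_separates_left:
  assumes "\<And>p q. u \<bullet> (p \<otimes>\<^bsub>AA\<^esub> q) = u' \<bullet> (p \<otimes>\<^bsub>AA\<^esub> q)"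
  shows "u = u'"
proof -
  have "tmap AA AA (\<lambda>x. x * p) id (tmap AA AA id (\<lambda>y. y * q) (u - u')) = 0" for p q
    using assms[of p q] by (simp add: tmult_tensor_right tmap_AA_tmap_AA lin_diff[OF lin_tmap_AA])
  then have "tmap AA AA id (\<lambda>y. y * q) (u - u') = 0" for q
    by (rule mult_right_separates[OF AA.tensor_product_axioms])
  then have "u - u' = 0"
    by (rule mult_right_separates_right)
  then show ?thesis by simp
qed

lemma tmult_separates_right:
  assumes "\<And>a b. (a \<otimes>\<^bsub>AA\<^esub> b) \<bullet> z = (a \<otimes>\<^bsub>AA\<^esub> b) \<bullet> z'"
  shows "z = z'"
proof -
  have "tmap AA AA ((*) a) id (tmap AA AA id ((*) b) (z - z')) = 0" for a b
    using assms[of a b] by (simp add: tmult_tensor_left tmap_AA_tmap_AA lin_diff[OF lin_tmap_AA])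
  then have "tmap AA AA id ((*) b) (z - z') = 0" for b
    by (rule mult_left_separates[OF AA.tensor_product_axioms])
  then have "z - z' = 0"
    by (rule mult_left_separates_right)
  then show ?thesis by simp
qed

end

section \<open>The comultiplication and the idempotent\<close>

context regular_weak_multiplier_bialgebra
begin

lemma lin_structure [simp]:
    "lin (tscale AA) (tscale AA) E1" "lin (tscale AA) (tscale AA) E2"
    "lin (tscale AA) (tscale AA) T1" "lin (tscale AA) (tscale AA) T2"
  by (simp_all add: linear_maps)

lemma lin_slices [simp]:
    "lin (tscale AA) sA (lslice sA AA \<epsilon>)" "lin (tscale AA) sA (rslice sA AA \<epsilon>)"
  by (simp_all add: AA.lin_lslice AA.lin_rslice linear_counit)

lemma lin_T1_slots [simp]:
    "lin sA (tscale AA) (\<lambda>x. T1 (x \<otimes>\<^bsub>AA\<^esub> y))" "lin sA (tscale AA) (\<lambda>y. T1 (x \<otimes>\<^bsub>AA\<^esub> y))"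
  by (rule lin_compose[OF AA.lin_tensor_left lin_structure(3)]
      lin_compose[OF AA.lin_tensor_right lin_structure(3)])+

lemma lin_T2_slots [simp]:
    "lin sA (tscale AA) (\<lambda>x. T2 (x \<otimes>\<^bsub>AA\<^esub> y))" "lin sA (tscale AA) (\<lambda>y. T2 (x \<otimes>\<^bsub>AA\<^esub> y))"
  by (rule lin_compose[OF AA.lin_tensor_left lin_structure(4)]
      lin_compose[OF AA.lin_tensor_right lin_structure(4)])+

lemma tmult_E1: "u \<bullet> E1 z = E2 u \<bullet> z"
proof (rule AA.tensor_ext[OF lin_tmult_left lin_compose[OF lin_structure(2) lin_tmult_left]])
  fix a b
  show "(a \<otimes>\<^bsub>AA\<^esub> b) \<bullet> E1 z = E2 (a \<otimes>\<^bsub>AA\<^esub> b) \<bullet> z"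
  proof (rule AA.tensor_ext[OF lin_compose[OF lin_structure(1) lin_tmult_right] lin_tmult_right])
    show "(a \<otimes>\<^bsub>AA\<^esub> b) \<bullet> E1 (c \<otimes>\<^bsub>AA\<^esub> d) = E2 (a \<otimes>\<^bsub>AA\<^esub> b) \<bullet> (c \<otimes>\<^bsub>AA\<^esub> d)" for c d
      using E1_E2 by (simp add: tmult_tensor_left tmult_tensor_right)
  qed
qed

text \<open>
  \<open>E1\<close> and \<open>E2\<close> are multiplications by the same idempotent from the left and from the right, by
  \<open>tmult_E1\<close>; multiplying by test elements on the other side turns one into the other.
\<close>

lemma E1_right_module:
  "E1 (tmap AA AA (\<lambda>x. x * p) (\<lambda>y. y * q) z) = tmap AA AA (\<lambda>x. x * p) (\<lambda>y. y * q) (E1 z)"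
  by (rule tmult_separates_right)
    (simp add: tmult_E1 tmult_tmap_right mult.assoc)

lemma E2_left_module:
  "E2 (tmap AA AA id ((*) c) u) = tmap AA AA id ((*) c) (E2 u)"
  by (rule tmult_separates_left)
    (simp add: tmult_E1[symmetric] tmult_tmap_left mult.assoc)

lemma E2_E2: "E2 (E2 u) = E2 u"
proof (rule tmult_separates_left)
  have "E1 (E1 z) = E1 z" for z
    using E1_idem by (metis comp_apply)
  then show "E2 (E2 u) \<bullet> (p \<otimes>\<^bsub>AA\<^esub> q) = E2 u \<bullet> (p \<otimes>\<^bsub>AA\<^esub> q)" for p q
    by (metis tmult_E1)
qed

text \<open>
  After multiplication of the second factor from the left, \<open>T2\<close> takes values in the span of the
  range of \<open>E2\<close>, which \<open>E2\<close> fixes; the multiplication is removed by non-degeneracy.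
\<close>

lemma E2_T2: "E2 (T2 (b \<otimes>\<^bsub>AA\<^esub> a)) = T2 (b \<otimes>\<^bsub>AA\<^esub> a)"
proof -
  interpret S: vector_space "tscale AA" by (rule AA.vector_space_tensor)
  interpret SS: vector_space_pair "tscale AA" "tscale AA" ..
  have "tmap AA AA id ((*) c) (E2 (T2 (b \<otimes>\<^bsub>AA\<^esub> a)) - T2 (b \<otimes>\<^bsub>AA\<^esub> a)) = 0" for c
  proof -
    let ?t = "tmap AA AA id ((*) c) (T2 (b \<otimes>\<^bsub>AA\<^esub> a))"
    have "?t \<in> S.span {E2 (b \<otimes>\<^bsub>AA\<^esub> c) | b c. True}"
      unfolding range_E2[symmetric] by (rule S.span_base) blast
    then have "E2 ?t = ?t"
      by (rule SS.linear_eq_on_span[OF lin_structure(2) lin_id_AA(2), rotated]) (auto simp: E2_E2)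
    then show ?thesis
      by (simp add: E2_left_module lin_diff[OF lin_tmap_AA])
  qed
  then have "E2 (T2 (b \<otimes>\<^bsub>AA\<^esub> a)) - T2 (b \<otimes>\<^bsub>AA\<^esub> a) = 0"
    by (rule mult_left_separates_right)
  then show ?thesis by simp
qed

lemma T2_tmult_E1: "T2 (b \<otimes>\<^bsub>AA\<^esub> a) \<bullet> E1 z = T2 (b \<otimes>\<^bsub>AA\<^esub> a) \<bullet> z"
  by (simp add: tmult_E1 E2_T2)

lemma lin_T2_A: "lin (tscale A_AA) (tscale A_AA) (tmap AA_A AA_A T2 id)"
  using lin_tmap[OF A3.UV_W A3.UV_W lin_structure(4) lin_id_A(1)] by (simp add: A3.tscale_eq)

lemma lin_A_map: "lin (tscale AA) (tscale AA) f \<Longrightarrow> lin (tscale A_AA) (tscale A_AA) (tmap A_AA A_AA id f)"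
  by (rule lin_tmap[OF A3.U_VW A3.U_VW lin_id_A(1)])

lemma T2_A_A_T1:
  "tmap AA_A AA_A T2 id (tmap A_AA A_AA id T1 t) = tmap A_AA A_AA id T1 (tmap AA_A AA_A T2 id t)"
  using coassociative by (metis comp_apply)

lemma lin_middle_slice: "lin (tscale A_AA) (tscale AA) (tmap A_AA AA id (lslice sA AA \<epsilon>))"
  by (rule lin_tmap[OF A3.U_VW A3.UV]) simp_all

text \<open>
  Both sides are \<open>A \<otimes> \<epsilon> \<otimes> A\<close>.  Applying the counit to the middle factor makes either \<open>T1\<close> on the
  last two factors or \<open>T2\<close> on the first two collapse to the multiplication.
\<close>

lemma middle_slice:
  "tmap A_AA AA id (lslice sA AA \<epsilon>) t = tmap AA_A AA (rslice sA AA \<epsilon>) id t"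
proof (rule A3.tensor3_ext[OF lin_middle_slice])
  interpret S: vector_space sA by (rule AA.vector_space_left)
  have l: "lin (tscale AA_A) (tscale AA) (tmap AA_A AA (rslice sA AA \<epsilon>) id)"
    by (rule lin_tmap[OF A3.UV_W A3.UV]) simp_all
  then show "lin (tscale A_AA) (tscale AA) (tmap AA_A AA (rslice sA AA \<epsilon>) id)"
    by (simp add: A3.tscale_eq)
  show "tmap A_AA AA id (lslice sA AA \<epsilon>) (u \<otimes>\<^bsub>A_AA\<^esub> (v \<otimes>\<^bsub>AA\<^esub> w)) =
      tmap AA_A AA (rslice sA AA \<epsilon>) id (u \<otimes>\<^bsub>A_AA\<^esub> (v \<otimes>\<^bsub>AA\<^esub> w))" for u v w
  proof -
    have "tmap A_AA AA id (lslice sA AA \<epsilon>) (u \<otimes>\<^bsub>A_AA\<^esub> (v \<otimes>\<^bsub>AA\<^esub> w)) = u \<otimes>\<^bsub>AA\<^esub> sA (\<epsilon> v) w"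
      by (subst tmap_tensor[OF A3.U_VW A3.UV]) (simp_all add: AA.lslice_tensor linear_counit)
    moreover have "tmap AA_A AA (rslice sA AA \<epsilon>) id (u \<otimes>\<^bsub>A_AA\<^esub> (v \<otimes>\<^bsub>AA\<^esub> w)) = sA (\<epsilon> v) u \<otimes>\<^bsub>AA\<^esub> w"
      unfolding A3.assoc[symmetric]
      by (subst tmap_tensor[OF A3.UV_W A3.UV]) (simp_all add: AA.rslice_tensor linear_counit)
    ultimately show ?thesis
      by (simp add: lin_scale[OF AA.lin_tensor_left] lin_scale[OF AA.lin_tensor_right])
  qed
qed

lemma middle_slice_T2:
  "tmap A_AA AA id (lslice sA AA \<epsilon>) (tmap AA_A AA_A T2 id t) = tmap AA_A AA \<mu> id t"
proof -
  have "rslice sA AA \<epsilon> (T2 s) = \<mu> s" for s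
    using counit_T2 by (metis comp_apply)
  then show ?thesis
    unfolding middle_slice
    by (subst tmap_tmap[OF A3.UV_W A3.UV_W A3.UV]) (simp_all add: id_def)
qed

lemma mult_first: "tmap AA_A AA \<mu> id (c \<otimes>\<^bsub>A_AA\<^esub> t) = tmap AA AA ((*) c) id t"
  by (subst A3.tmap_assoc_left[OF A3.UV]) simp_all

text \<open>
  Both sides are \<open>c z\<^sub>1 \<otimes> z\<^sub>2 w\<close>: this is coassociativity with the counit applied to the middle
  factor.
\<close>

lemma T1_via_T2: "tmap AA AA ((*) c) id (T1 (z \<otimes>\<^bsub>AA\<^esub> w)) = tmap AA AA id (\<lambda>y. y * w) (T2 (c \<otimes>\<^bsub>AA\<^esub> z))"
proof -
  let ?m = "tmap A_AA AA id (lslice sA AA \<epsilon>)" and ?t = "c \<otimes>\<^bsub>A_AA\<^esub> (z \<otimes>\<^bsub>AA\<^esub> w)"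
  have "tmap AA AA ((*) c) id (T1 (z \<otimes>\<^bsub>AA\<^esub> w)) = ?m (tmap AA_A AA_A T2 id (tmap A_AA A_AA id T1 ?t))"
    unfolding middle_slice_T2
    by (subst tmap_tensor[OF A3.U_VW A3.U_VW]) (simp_all add: mult_first)
  also have "\<dots> = ?m (tmap A_AA A_AA id T1 (tmap AA_A AA_A T2 id ?t))"
    by (simp add: T2_A_A_T1)
  also have "\<dots> = tmap A_AA AA id \<mu> (tmap AA_A AA_A T2 id ?t)"
  proof -
    have "lslice sA AA \<epsilon> (T1 s) = \<mu> s" for s
      using counit_T1 by (metis comp_apply)
    then show ?thesis by (subst tmap_tmap[OF A3.U_VW A3.U_VW A3.UV]) (simp_all add: id_def)
  qed
  also have "\<dots> = tmap A_AA AA id \<mu> (T2 (c \<otimes>\<^bsub>AA\<^esub> z) \<otimes>\<^bsub>AA_A\<^esub> w)"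
    unfolding A3.assoc[symmetric]
    by (subst tmap_tensor[OF A3.UV_W A3.UV_W]) simp_all
  also have "\<dots> = tmap AA AA id (\<lambda>y. y * w) (T2 (c \<otimes>\<^bsub>AA\<^esub> z))"
    by (subst A3.tmap_assoc_right[OF A3.UV]) simp_all
  finally show ?thesis .
qed

text \<open>
  Both sides are \<open>c x\<^sub>1 p\<^sub>1 \<otimes> x\<^sub>2 p\<^sub>2 q\<close>, by multiplicativity of the comultiplication.
\<close>

lemma T2_tmult_T1: "T2 (c \<otimes>\<^bsub>AA\<^esub> x) \<bullet> T1 (p \<otimes>\<^bsub>AA\<^esub> q) = tmap AA AA ((*) c) id (T1 ((x * p) \<otimes>\<^bsub>AA\<^esub> q))"
proof -
  let ?l = "leg13 AA AA A_AA T1" and ?c = "tmap AA AA ((*) c) id"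
  have lin_l: "lin (tscale A_AA) (tscale A_AA) ?l"
    by (rule lin_leg13[OF A3.UV A3.UV A3.U_VW]) simp
  have lin_m: "lin (tscale A_AA) (tscale AA) (tmap AA_A AA \<mu> id)"
    using lin_tmap[OF A3.UV_W A3.UV lin_mu lin_id_A(1)] by (simp add: A3.tscale_eq)
  have eq: "?c (tmap AA_A AA \<mu> id (?l (x \<otimes>\<^bsub>A_AA\<^esub> t))) = T2 (c \<otimes>\<^bsub>AA\<^esub> x) \<bullet> t" for t
  proof (rule AA.tensor_ext[OF _ lin_tmult_right])
    show "lin (tscale AA) (tscale AA) (\<lambda>t. ?c (tmap AA_A AA \<mu> id (?l (x \<otimes>\<^bsub>A_AA\<^esub> t))))"
      by (rule lin_compose[OF lin_compose[OF lin_compose[OF A_AA.lin_tensor_right lin_l] lin_m] lin_tmap_AA])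
        simp_all
    fix p' q'
    have "tmap AA_A AA \<mu> id (tmap AA A_AA id (\<lambda>w. p' \<otimes>\<^bsub>AA\<^esub> w) s) = tmap AA AA (\<lambda>v. v * p') id s" for s
    proof (rule AA.tensor_ext[OF lin_compose[OF lin_tmap[OF A3.UV A3.U_VW] lin_m] lin_tmap_AA])
      show "tmap AA_A AA \<mu> id (tmap AA A_AA id (\<lambda>w. p' \<otimes>\<^bsub>AA\<^esub> w) (y \<otimes>\<^bsub>AA\<^esub> w)) =
          tmap AA AA (\<lambda>v. v * p') id (y \<otimes>\<^bsub>AA\<^esub> w)" for y w
        by (subst tmap_tensor[OF A3.UV A3.U_VW]) (simp_all add: mult_first)
    qed simp_all
    then have "?c (tmap AA_A AA \<mu> id (?l (x \<otimes>\<^bsub>A_AA\<^esub> (p' \<otimes>\<^bsub>AA\<^esub> q')))) =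
        tmap AA AA (\<lambda>v. v * p') id (?c (T1 (x \<otimes>\<^bsub>AA\<^esub> q')))"
      by (simp add: leg13_tensor[OF A3.UV A3.UV A3.U_VW] tmap_AA_tmap_AA mult.assoc)
    also have "\<dots> = T2 (c \<otimes>\<^bsub>AA\<^esub> x) \<bullet> (p' \<otimes>\<^bsub>AA\<^esub> q')"
      by (simp add: T1_via_T2 tmult_tensor_right tmap_AA_tmap_AA)
    finally show "?c (tmap AA_A AA \<mu> id (?l (x \<otimes>\<^bsub>A_AA\<^esub> (p' \<otimes>\<^bsub>AA\<^esub> q')))) =
        T2 (c \<otimes>\<^bsub>AA\<^esub> x) \<bullet> (p' \<otimes>\<^bsub>AA\<^esub> q')" .
  qed
  have "T1 ((x * p) \<otimes>\<^bsub>AA\<^esub> q) = T1 (tmap AA_A AA \<mu> id (x \<otimes>\<^bsub>A_AA\<^esub> (p \<otimes>\<^bsub>AA\<^esub> q)))"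
    by (simp add: mult_first)
  also have "\<dots> = tmap AA_A AA \<mu> id (?l (tmap A_AA A_AA id T1 (x \<otimes>\<^bsub>A_AA\<^esub> (p \<otimes>\<^bsub>AA\<^esub> q))))"
    using multiplicative by (metis comp_apply)
  also have "tmap A_AA A_AA id T1 (x \<otimes>\<^bsub>A_AA\<^esub> (p \<otimes>\<^bsub>AA\<^esub> q)) = x \<otimes>\<^bsub>A_AA\<^esub> T1 (p \<otimes>\<^bsub>AA\<^esub> q)"
    by (subst tmap_tensor[OF A3.U_VW A3.U_VW]) simp_all
  finally show ?thesis
    by (simp only: eq)
qed

text \<open>
  The map \<open>y \<mapsto> (A \<otimes> \<epsilon>) T1(y \<otimes> x)\<close> is the right multiplication by the multiplier
  \<open>bar_R sA AA E1 T1 \<epsilon> x\<close>, so \<open>T2\<close> turns this multiplication into the multiplication of the second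
  factor.  This is coassociativity with the counit applied to the last factor.
\<close>

lemma T2_bar_R:
  "T2 (c \<otimes>\<^bsub>AA\<^esub> rslice sA AA \<epsilon> (T1 (a \<otimes>\<^bsub>AA\<^esub> x))) =
    tmap AA AA id (\<lambda>y. rslice sA AA \<epsilon> (T1 (y \<otimes>\<^bsub>AA\<^esub> x))) (T2 (c \<otimes>\<^bsub>AA\<^esub> a))"
proof -
  let ?n = "rslice (tscale AA) AA_A \<epsilon>" and ?t = "c \<otimes>\<^bsub>A_AA\<^esub> (a \<otimes>\<^bsub>AA\<^esub> x)"
  have lin_n: "lin (tscale A_AA) (tscale AA) ?n"
    using AA_A.lin_rslice[OF linear_counit] by (simp add: A3.tscale_eq)
  have n: "?n t = tmap A_AA AA id (rslice sA AA \<epsilon>) t" for t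
  proof (rule A3.tensor3_ext[OF lin_n lin_tmap[OF A3.U_VW A3.UV]])
    show "?n (u \<otimes>\<^bsub>A_AA\<^esub> (v \<otimes>\<^bsub>AA\<^esub> w)) =
        tmap A_AA AA id (rslice sA AA \<epsilon>) (u \<otimes>\<^bsub>A_AA\<^esub> (v \<otimes>\<^bsub>AA\<^esub> w))" for u v w
      unfolding tmap_tensor[OF A3.U_VW A3.UV lin_id_A(1) lin_slices(2)]
      unfolding A3.assoc[symmetric]
      by (simp add: AA_A.rslice_tensor AA.rslice_tensor linear_counit lin_scale[OF AA.lin_tensor_right])
  qed simp_all
  have "?n (tmap A_AA A_AA id T1 ?t) = c \<otimes>\<^bsub>AA\<^esub> rslice sA AA \<epsilon> (T1 (a \<otimes>\<^bsub>AA\<^esub> x))"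
    unfolding n
    by (subst tmap_tensor[OF A3.U_VW A3.U_VW], simp, simp, subst tmap_tensor[OF A3.U_VW A3.UV]) simp_all
  then have "T2 (c \<otimes>\<^bsub>AA\<^esub> rslice sA AA \<epsilon> (T1 (a \<otimes>\<^bsub>AA\<^esub> x))) = ?n (tmap AA_A AA_A T2 id (tmap A_AA A_AA id T1 ?t))"
    by (simp add: rslice_tmap[OF A3.UV_W A3.UV_W] linear_counit)
  also have "\<dots> = ?n (tmap A_AA A_AA id T1 (T2 (c \<otimes>\<^bsub>AA\<^esub> a) \<otimes>\<^bsub>AA_A\<^esub> x))"
    unfolding T2_A_A_T1 A3.assoc[symmetric]
    by (subst tmap_tensor[OF A3.UV_W A3.UV_W]) simp_all
  also have "\<dots> = tmap A_AA AA id (\<lambda>s. rslice sA AA \<epsilon> (T1 s)) (T2 (c \<otimes>\<^bsub>AA\<^esub> a) \<otimes>\<^bsub>AA_A\<^esub> x)"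
    unfolding n by (subst tmap_tmap[OF A3.U_VW A3.U_VW A3.UV]) (simp_all add: id_def)
  also have "\<dots> = tmap AA AA id (\<lambda>y. rslice sA AA \<epsilon> (T1 (y \<otimes>\<^bsub>AA\<^esub> x))) (T2 (c \<otimes>\<^bsub>AA\<^esub> a))"
    by (subst A3.tmap_assoc_right[OF A3.UV])
      (simp_all add: lin_compose[OF lin_structure(3) lin_slices(2)])
  finally show ?thesis .
qed

end

section \<open>The antipode\<close>

context regular_weak_multiplier_bialgebra
begin

text \<open>
  For \<open>s = p \<otimes> q\<close> and \<open>t = y \<otimes> z\<close> both sides are \<open>p \<otimes> h q y \<otimes> z\<close>.  The lemma lets maps be
  applied to two independent elements of \<open>A \<otimes> A\<close> in either order.
\<close>

lemma tmap_exchange: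
  assumes hl: "\<And>y. lin sA sA (\<lambda>z. h z y)" and hr: "\<And>z. lin sA sA (h z)"
  shows "tmap AA AA_A (\<lambda>y. tmap AA AA id (\<lambda>z. h z y) s) id t =
    tmap AA A_AA id (\<lambda>x. tmap AA AA (h x) id t) s"
proof (rule AA.tensor_ext[where f = "\<lambda>s. tmap AA AA_A (\<lambda>y. tmap AA AA id (\<lambda>z. h z y) s) id t" and t = s])
  have l: "lin sA (tscale AA) (\<lambda>y. tmap AA AA id (\<lambda>z. h z y) s)" for s
    by (rule lin_tmap_param_right[OF A3.UV A3.UV AA.vector_space_left lin_id_A(1) hl hr])
  show "lin (tscale AA) (tscale A_AA) (\<lambda>s. tmap AA AA_A (\<lambda>y. tmap AA AA id (\<lambda>z. h z y) s) id t)"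
    by (rule lin_tmap_param_left[OF A3.UV A3.UV_W AA.vector_space_tensor l lin_tmap_AA[OF lin_id_A(1) hl]
          lin_id_A(1), unfolded A3.tscale_eq])
  have r: "lin sA (tscale AA) (\<lambda>x. tmap AA AA (h x) id t)"
    by (rule lin_tmap_param_left[OF A3.UV A3.UV AA.vector_space_left hr hl lin_id_A(1)])
  show "lin (tscale AA) (tscale A_AA) (tmap AA A_AA id (\<lambda>x. tmap AA AA (h x) id t))"
    by (rule lin_tmap[OF A3.UV A3.U_VW lin_id_A(1) r])
  fix p q
  have "tmap AA AA_A (\<lambda>y. p \<otimes>\<^bsub>AA\<^esub> h q y) id t = p \<otimes>\<^bsub>A_AA\<^esub> tmap AA AA (h q) id t"
  proof (rule AA.tensor_ext[where g = "\<lambda>t. p \<otimes>\<^bsub>A_AA\<^esub> tmap AA AA (h q) id t" and t = t])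
    have l': "lin sA (tscale AA) (\<lambda>y. p \<otimes>\<^bsub>AA\<^esub> h q y)"
      by (rule lin_compose[OF hr AA.lin_tensor_right])
    show "lin (tscale AA) (tscale A_AA) (tmap AA AA_A (\<lambda>y. p \<otimes>\<^bsub>AA\<^esub> h q y) id)"
      by (rule lin_tmap[OF A3.UV A3.UV_W l' lin_id_A(1), unfolded A3.tscale_eq])
    show "lin (tscale AA) (tscale A_AA) (\<lambda>t. p \<otimes>\<^bsub>A_AA\<^esub> tmap AA AA (h q) id t)"
      by (rule lin_compose[OF lin_tmap_AA[OF hr lin_id_A(1)] A_AA.lin_tensor_right])
    show "tmap AA AA_A (\<lambda>y. p \<otimes>\<^bsub>AA\<^esub> h q y) id (y \<otimes>\<^bsub>AA\<^esub> z) =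
        p \<otimes>\<^bsub>A_AA\<^esub> tmap AA AA (h q) id (y \<otimes>\<^bsub>AA\<^esub> z)" for y z
      by (simp add: tmap_tensor[OF A3.UV A3.UV_W l' lin_id_A(1)] hr A3.assoc)
  qed
  then show "tmap AA AA_A (\<lambda>y. tmap AA AA id (\<lambda>z. h z y) (p \<otimes>\<^bsub>AA\<^esub> q)) id t =
      tmap AA A_AA id (\<lambda>x. tmap AA AA (h x) id t) (p \<otimes>\<^bsub>AA\<^esub> q)"
    by (simp add: tmap_tensor[OF A3.UV A3.U_VW lin_id_A(1) r] hl)
qed

text \<open>
  \<open>G1\<close> multiplies the first of its two factors from the right by multipliers
  \<open>bar_R sA AA E1 T1 \<epsilon> y\<close>, which \<open>T2\<close> moves to its second factor.
\<close>

lemma T2_A_A_G1: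
  assumes G1: "is_G1 sA AA E1 T1 T4 \<epsilon> G1"
  shows "tmap AA_A AA_A T2 id (tmap A_AA A_AA id G1 t) = tmap A_AA A_AA id G1 (tmap AA_A AA_A T2 id t)"
proof (rule A3.tensor3_ext[where f = "\<lambda>t. tmap AA_A AA_A T2 id (tmap A_AA A_AA id G1 t)"
      and g = "\<lambda>t. tmap A_AA A_AA id G1 (tmap AA_A AA_A T2 id t)" and t = t])
  let ?h = "\<lambda>x y. rslice sA AA \<epsilon> (T1 (x \<otimes>\<^bsub>AA\<^esub> y))"
  have lin_G1 [simp]: "lin (tscale AA) (tscale AA) G1"
    using G1 by (simp add: is_G1_def)
  have G1_eq: "G1 (a \<otimes>\<^bsub>AA\<^esub> (b * d)) = tmap AA AA (?h a) id (flip AA AA (T4 (d \<otimes>\<^bsub>AA\<^esub> b)))" for a b d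
    using G1 by (simp add: is_G1_def bar_R_def)
  have hl: "lin sA sA (\<lambda>z. ?h z y)" and hr: "lin sA sA (?h z)" for y z
    by (rule lin_compose[OF lin_T1_slots(1) lin_slices(2)] lin_compose[OF lin_T1_slots(2) lin_slices(2)])+
  show l1: "lin (tscale A_AA) (tscale A_AA) (\<lambda>t. tmap AA_A AA_A T2 id (tmap A_AA A_AA id G1 t))"
    by (rule lin_compose[OF lin_A_map lin_T2_A]) simp
  show l2: "lin (tscale A_AA) (tscale A_AA) (\<lambda>t. tmap A_AA A_AA id G1 (tmap AA_A AA_A T2 id t))"
    by (rule lin_compose[OF lin_T2_A lin_A_map]) simp
  fix c a y
  have w: "lin sA (tscale A_AA) (\<lambda>y. c \<otimes>\<^bsub>A_AA\<^esub> (a \<otimes>\<^bsub>AA\<^esub> y))"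
    by (rule lin_compose[OF AA.lin_tensor_right A_AA.lin_tensor_right])
  show "tmap AA_A AA_A T2 id (tmap A_AA A_AA id G1 (c \<otimes>\<^bsub>A_AA\<^esub> (a \<otimes>\<^bsub>AA\<^esub> y))) =
      tmap A_AA A_AA id G1 (tmap AA_A AA_A T2 id (c \<otimes>\<^bsub>A_AA\<^esub> (a \<otimes>\<^bsub>AA\<^esub> y)))"
  proof (rule linear_eq_on_products[OF lin_compose[OF w l1] lin_compose[OF w l2]])
    fix b d
    let ?t = "flip AA AA (T4 (d \<otimes>\<^bsub>AA\<^esub> b))" and ?s = "T2 (c \<otimes>\<^bsub>AA\<^esub> a)"
    have "tmap AA_A AA_A T2 id (tmap A_AA A_AA id G1 (c \<otimes>\<^bsub>A_AA\<^esub> (a \<otimes>\<^bsub>AA\<^esub> (b * d)))) =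
        tmap AA_A AA_A T2 id (c \<otimes>\<^bsub>A_AA\<^esub> tmap AA AA (?h a) id ?t)"
      by (simp add: tmap_tensor[OF A3.U_VW A3.U_VW] G1_eq)
    also have "\<dots> = tmap AA AA_A (\<lambda>x. T2 (c \<otimes>\<^bsub>AA\<^esub> x)) id (tmap AA AA (?h a) id ?t)"
      by (simp add: A3.tmap_assoc_left[OF A3.UV_W])
    also have "\<dots> = tmap AA AA_A (\<lambda>y. T2 (c \<otimes>\<^bsub>AA\<^esub> ?h a y)) id ?t"
      by (subst tmap_tmap[OF A3.UV A3.UV A3.UV_W]) (simp_all add: hr id_def)
    also have "\<dots> = tmap AA A_AA id (\<lambda>x. tmap AA AA (?h x) id ?t) ?s"
      unfolding T2_bar_R by (rule tmap_exchange[OF hl hr])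
    also have "\<dots> = tmap AA A_AA id (\<lambda>x. G1 (x \<otimes>\<^bsub>AA\<^esub> (b * d))) ?s"
      by (simp add: G1_eq)
    also have "\<dots> = tmap A_AA A_AA id G1 (?s \<otimes>\<^bsub>AA_A\<^esub> (b * d))"
      by (simp add: A3.tmap_assoc_right[OF A3.U_VW])
    also have "\<dots> = tmap A_AA A_AA id G1 (tmap AA_A AA_A T2 id (c \<otimes>\<^bsub>A_AA\<^esub> (a \<otimes>\<^bsub>AA\<^esub> (b * d))))"
      by (simp add: A3.assoc[symmetric] tmap_tensor[OF A3.UV_W A3.UV_W])
    finally show "tmap AA_A AA_A T2 id (tmap A_AA A_AA id G1 (c \<otimes>\<^bsub>A_AA\<^esub> (a \<otimes>\<^bsub>AA\<^esub> (b * d)))) =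
        tmap A_AA A_AA id G1 (tmap AA_A AA_A T2 id (c \<otimes>\<^bsub>A_AA\<^esub> (a \<otimes>\<^bsub>AA\<^esub> (b * d))))" .
  qed
qed

text \<open>
  \<open>T2 \<otimes> A\<close> commutes with \<open>A \<otimes> T1\<close> and with \<open>A \<otimes> G1\<close>.  As \<open>E1 = T1 R1\<close>, \<open>R1 T1 = G1\<close> and
  \<open>G1 R1 = R1\<close>, it therefore commutes with \<open>A \<otimes> R1\<close> on the range of \<open>A \<otimes> E1\<close>.
\<close>

lemma T2_A_A_R1:
  assumes G1: "is_G1 sA AA E1 T1 T4 \<epsilon> G1" and R1 [simp]: "lin (tscale AA) (tscale AA) R1"
    and RT: "R1 \<circ> T1 = G1" and TR: "T1 \<circ> R1 = E1" and RTR: "R1 \<circ> T1 \<circ> R1 = R1"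
  shows "tmap AA_A AA_A T2 id (tmap A_AA A_AA id R1 t) =
    tmap A_AA A_AA id R1 (tmap AA_A AA_A T2 id (tmap A_AA A_AA id E1 t))"
proof -
  have lin_G1 [simp]: "lin (tscale AA) (tscale AA) G1"
    using G1 by (simp add: is_G1_def)
  have comp: "tmap A_AA A_AA id f (tmap A_AA A_AA id g t) = tmap A_AA A_AA id (f \<circ> g) t"
    if "lin (tscale AA) (tscale AA) f" "lin (tscale AA) (tscale AA) g" for f g t
    using tmap_tmap[OF A3.U_VW A3.U_VW A3.U_VW lin_id_A(1) that(2) lin_id_A(1) that(1)]
    by (simp add: comp_def id_def)
  have GR: "G1 \<circ> R1 = R1"
    using RT RTR by simp
  have "tmap A_AA A_AA id R1 (tmap AA_A AA_A T2 id (tmap A_AA A_AA id E1 t)) =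
      tmap A_AA A_AA id R1 (tmap AA_A AA_A T2 id (tmap A_AA A_AA id T1 (tmap A_AA A_AA id R1 t)))"
    by (simp add: comp TR)
  also have "\<dots> = tmap A_AA A_AA id R1 (tmap A_AA A_AA id T1 (tmap AA_A AA_A T2 id (tmap A_AA A_AA id R1 t)))"
    by (simp add: T2_A_A_T1)
  also have "\<dots> = tmap AA_A AA_A T2 id (tmap A_AA A_AA id G1 (tmap A_AA A_AA id R1 t))"
    unfolding T2_A_A_G1[OF G1] by (simp add: comp RT)
  also have "\<dots> = tmap AA_A AA_A T2 id (tmap A_AA A_AA id R1 t)"
    by (simp add: comp GR)
  finally show ?thesis ..
qed

text \<open>
  This is the formula \<open>c a\<^sub>1 \<otimes> S(a\<^sub>2) b\<close> for \<open>(c \<otimes> 1) R1(a \<otimes> b)\<close>, with \<open>E1\<close> inserted: the counit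
  is applied to the middle factor in \<open>T2_A_A_R1\<close>.
\<close>

lemma R1_via_antipode:
  assumes G1: "is_G1 sA AA E1 T1 T4 \<epsilon> G1" and R1 [simp]: "lin (tscale AA) (tscale AA) R1"
    and RT: "R1 \<circ> T1 = G1" and TR: "T1 \<circ> R1 = E1" and RTR: "R1 \<circ> T1 \<circ> R1 = R1"
  shows "tmap AA AA ((*) c) id (R1 w) =
    tmap A_AA AA id (\<lambda>s. lslice sA AA \<epsilon> (R1 s)) (tmap AA_A AA_A T2 id (c \<otimes>\<^bsub>A_AA\<^esub> E1 w))"
proof -
  have "tmap AA AA ((*) c) id (R1 w) =
      tmap A_AA AA id (lslice sA AA \<epsilon>) (tmap AA_A AA_A T2 id (tmap A_AA A_AA id R1 (c \<otimes>\<^bsub>A_AA\<^esub> w)))"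
    unfolding middle_slice_T2 by (simp add: tmap_tensor[OF A3.U_VW A3.U_VW] mult_first)
  also have "\<dots> = tmap A_AA AA id (lslice sA AA \<epsilon>)
      (tmap A_AA A_AA id R1 (tmap AA_A AA_A T2 id (c \<otimes>\<^bsub>A_AA\<^esub> E1 w)))"
    unfolding T2_A_A_R1[OF assms] by (simp add: tmap_tensor[OF A3.U_VW A3.U_VW])
  also have "\<dots> = tmap A_AA AA id (\<lambda>s. lslice sA AA \<epsilon> (R1 s)) (tmap AA_A AA_A T2 id (c \<otimes>\<^bsub>A_AA\<^esub> E1 w))"
    by (subst tmap_tmap[OF A3.U_VW A3.U_VW A3.UV]) (simp_all add: id_def)
  finally show ?thesis .
qed

text \<open>
  The hypothesis gives \<open>E2(u) (x \<otimes> d) = u E1(x \<otimes> d) = 0\<close>, hence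
  \<open>b a\<^sub>1 x \<otimes> a\<^sub>2 d = 0\<close> because \<open>E2\<close> fixes the range of \<open>T2\<close>.  By fullness the first factors \<open>a\<^sub>1\<close>
  exhaust \<open>A\<close>, so \<open>A x = 0\<close>.
\<close>

lemma E1_separates:
  assumes full: "right_full sA AA T1" and zero: "\<And>d. E1 (x \<otimes>\<^bsub>AA\<^esub> d) = 0"
  shows "x = 0"
proof -
  interpret S: vector_space "tscale AA" by (rule AA.vector_space_tensor)
  interpret SS: vector_space_pair "tscale AA" "tscale AA" ..
  interpret V: vector_space sA by (rule AA.vector_space_left)
  interpret VV: vector_space_pair sA sA ..
  have E2x: "E2 u \<bullet> (x \<otimes>\<^bsub>AA\<^esub> d) = 0" for u d
    unfolding tmult_E1[symmetric] zero by (rule lin_zero[OF lin_tmult_right])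
  have "tmap AA AA (\<lambda>z. z * x) id (T1 (a \<otimes>\<^bsub>AA\<^esub> d)) = 0" for a d
  proof (rule mult_left_separates[OF A3.UV])
    fix b
    have "tmap AA AA (\<lambda>z. z * x) id (tmap AA AA ((*) b) id (T1 (a \<otimes>\<^bsub>AA\<^esub> d))) = T2 (b \<otimes>\<^bsub>AA\<^esub> a) \<bullet> (x \<otimes>\<^bsub>AA\<^esub> d)"
      by (simp add: T1_via_T2 tmult_tensor_right tmap_AA_tmap_AA)
    also have "\<dots> = 0"
      using E2x[of "T2 (b \<otimes>\<^bsub>AA\<^esub> a)"] by (simp add: E2_T2)
    finally show "tmap AA AA ((*) b) id (tmap AA AA (\<lambda>z. z * x) id (T1 (a \<otimes>\<^bsub>AA\<^esub> d))) = 0"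
      by (simp add: tmap_AA_tmap_AA mult.assoc)
  qed
  then have "rslice sA AA \<omega> (T1 (a \<otimes>\<^bsub>AA\<^esub> d)) * x = 0" if "lin sA (*) \<omega>" for a d \<omega>
    using rslice_tmap[OF A3.UV A3.UV lin_mult_right lin_id_A(1) that, of x "T1 (a \<otimes>\<^bsub>AA\<^esub> d)"]
      lin_zero[OF AA.lin_rslice[OF that]] by simp
  then have "y * x = 0" if "y \<in> V.span {rslice sA AA \<omega> (T1 (a \<otimes>\<^bsub>AA\<^esub> b)) | a b \<omega>. lin sA (*) \<omega>}" for y
    by (intro VV.linear_eq_0_on_span[OF lin_mult_right[of x] _ that]) auto
  then have "\<forall>y. y * x = 0"
    using full unfolding right_full_def by simp
  then show ?thesis
    by (rule nondegenerate_left)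
qed

end

section \<open>Slices of a comodule\<close>

locale left_comodule_slice =
  regular_weak_multiplier_bialgebra sA AA AA_A A_AA E1 E2 T1 T2 T3 T4 \<epsilon> +
  left_comodule sV sA AV AA AA_V A_AV E1 T1 lam rho
  for sA :: "'k::field \<Rightarrow> 'a::ring \<Rightarrow> 'a"
    and sV :: "'k \<Rightarrow> 'v::ab_group_add \<Rightarrow> 'v"
    and AA :: "('k, 'a, 'a, 'aa::ab_group_add) tensor_space"
    and AA_A :: "('k, 'aa, 'a, 'aaa::ab_group_add) tensor_space"
    and A_AA :: "('k, 'a, 'aa, 'aaa) tensor_space"
    and AV :: "('k, 'a, 'v, 'av::ab_group_add) tensor_space"
    and AA_V :: "('k, 'aa, 'v, 'aav::ab_group_add) tensor_space"
    and A_AV :: "('k, 'a, 'av, 'aav) tensor_space"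
    and E1 E2 T1 T2 T3 T4 :: "'aa \<Rightarrow> 'aa"
    and \<epsilon> :: "'a \<Rightarrow> 'k"
    and lam rho :: "'av \<Rightarrow> 'av" +
  fixes \<theta> :: "'v \<Rightarrow> 'k"
  assumes linear_functional: "lin sV (*) \<theta>"
begin

sublocale V3: associative_tensors sA sA sV AA AV AA_V A_AV
  by (unfold_locales) (rule tensor3_V)

sublocale AV: tensor_product sA sV AV
  by (rule V3.VW)

sublocale AA_V: tensor_product "tscale AA" sV AA_V
  by (rule V3.UV_W)

sublocale A_AV: tensor_product sA "tscale AV" A_AV
  by (rule V3.U_VW)

text \<open>The element \<open>v\<^sub>-\<^sub>1 b \<theta>(v\<^sub>0)\<close> of \<open>A\<close>.\<close>

definition lam_slice :: "'a \<Rightarrow> 'v \<Rightarrow> 'a" where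
  "lam_slice b v = rslice sA AV \<theta> (lam (b \<otimes>\<^bsub>AV\<^esub> v))"

text \<open>The element \<open>b v\<^sub>-\<^sub>1 \<theta>(v\<^sub>0)\<close> of \<open>A\<close>.\<close>

definition rho_slice :: "'a \<Rightarrow> 'v \<Rightarrow> 'a" where
  "rho_slice b v = rslice sA AV \<theta> (rho (b \<otimes>\<^bsub>AV\<^esub> v))"

lemma lin_slice: "lin (tscale AV) sA (rslice sA AV \<theta>)"
  by (rule AV.lin_rslice[OF linear_functional])

lemma lin_id_V: "lin sV sV id"
  by (rule lin_id[OF AV.vector_space_right])

lemma lin_lam_slice [simp]:
    "lin sA sA (\<lambda>b. lam_slice b v)" "lin sV sA (lam_slice b)"
  unfolding lam_slice_def
  by (rule lin_compose[OF lin_compose[OF AV.lin_tensor_left linear_lam] lin_slice]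
      lin_compose[OF lin_compose[OF AV.lin_tensor_right linear_lam] lin_slice])+

lemma lin_rho_slice [simp]:
    "lin sA sA (\<lambda>b. rho_slice b v)" "lin sV sA (rho_slice b)"
  unfolding rho_slice_def
  by (rule lin_compose[OF lin_compose[OF AV.lin_tensor_left linear_rho] lin_slice]
      lin_compose[OF lin_compose[OF AV.lin_tensor_right linear_rho] lin_slice])+

lemma lam_slice_rho_slice: "a * lam_slice b v = rho_slice a v * b"
proof -
  have "a * lam_slice b v = rslice sA AV \<theta> (tmap AV AV ((*) a) id (lam (b \<otimes>\<^bsub>AV\<^esub> v)))"
    by (simp add: rslice_tmap[OF V3.VW V3.VW lin_mult_left lin_id_V linear_functional] lam_slice_def)
  also have "\<dots> = rslice sA AV \<theta> (tmap AV AV (\<lambda>x. x * b) id (rho (a \<otimes>\<^bsub>AV\<^esub> v)))"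
    by (simp add: lam_rho)
  also have "\<dots> = rho_slice a v * b"
    by (simp add: rslice_tmap[OF V3.VW V3.VW lin_mult_right lin_id_V linear_functional] rho_slice_def)
  finally show ?thesis .
qed

text \<open>
  \<open>lam_slice_rho_slice\<close> determines \<open>rho_slice a v\<close> by its products with elements on the right.
\<close>

lemma rho_slice_mult: "rho_slice (a * b) v = a * rho_slice b v"
proof -
  have "(rho_slice (a * b) v - a * rho_slice b v) * d = 0" for d
    using lam_slice_rho_slice[of "a * b" d v] lam_slice_rho_slice[of b d v]
    by (simp add: left_diff_distrib mult.assoc)
  then have "rho_slice (a * b) v - a * rho_slice b v = 0"
    using nondegenerate_right by blast
  then show ?thesis by simp
qed

text \<open>
  The operator \<open>p \<otimes> q \<mapsto> v\<^sub>-\<^sub>2 p \<otimes> v\<^sub>-\<^sub>1 q \<theta>(v\<^sub>0)\<close>, the form in which the twice iterated coaction enters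
  the axioms of a comodule.
\<close>

definition lam_slice2 :: "'v \<Rightarrow> 'aa \<Rightarrow> 'aa" where
  "lam_slice2 v t = rslice (tscale AA) AA_V \<theta>
     (tmap A_AV A_AV id lam (leg13 AV AV A_AV lam (t \<otimes>\<^bsub>AA_V\<^esub> v)))"

lemma lin_leg13_lam: "lin (tscale A_AV) (tscale A_AV) (leg13 AV AV A_AV lam)"
  by (rule lin_leg13[OF V3.VW V3.VW V3.U_VW linear_lam])

lemma lin_slice3: "lin (tscale A_AV) (tscale AA) (rslice (tscale AA) AA_V \<theta>)"
  using AA_V.lin_rslice[OF linear_functional] by (simp add: V3.tscale_eq)

lemma lin_lam_slice2 [simp]: "lin (tscale AA) (tscale AA) (lam_slice2 v)"
proof -
  have l: "lin (tscale A_AV) (tscale A_AV) (tmap A_AV A_AV id lam)"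
    by (rule lin_tmap[OF V3.U_VW V3.U_VW lin_id_A(1) linear_lam])
  have t: "lin (tscale AA) (tscale A_AV) (\<lambda>t. t \<otimes>\<^bsub>AA_V\<^esub> v)"
    using AA_V.lin_tensor_left by (simp add: V3.tscale_eq)
  show ?thesis
    unfolding lam_slice2_def
    by (rule lin_compose[OF lin_compose[OF lin_compose[OF t lin_leg13_lam] l] lin_slice3])
qed

lemma slice3: "rslice (tscale AA) AA_V \<theta> t = tmap A_AV AA id (rslice sA AV \<theta>) t"
proof (rule V3.tensor3_ext[OF lin_slice3 lin_tmap[OF V3.U_VW A3.UV lin_id_A(1) lin_slice]])
  fix a b v
  have "rslice (tscale AA) AA_V \<theta> ((a \<otimes>\<^bsub>AA\<^esub> b) \<otimes>\<^bsub>AA_V\<^esub> v) = a \<otimes>\<^bsub>AA\<^esub> sA (\<theta> v) b"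
    by (simp add: AA_V.rslice_tensor linear_functional lin_scale[OF AA.lin_tensor_right])
  then show "rslice (tscale AA) AA_V \<theta> (a \<otimes>\<^bsub>A_AV\<^esub> (b \<otimes>\<^bsub>AV\<^esub> v)) =
      tmap A_AV AA id (rslice sA AV \<theta>) (a \<otimes>\<^bsub>A_AV\<^esub> (b \<otimes>\<^bsub>AV\<^esub> v))"
    by (simp add: V3.assoc tmap_tensor[OF V3.U_VW A3.UV lin_id_A(1) lin_slice]
        AV.rslice_tensor linear_functional)
qed

lemma leg13_lam:
  "leg13 AV AV A_AV lam ((p \<otimes>\<^bsub>AA\<^esub> q) \<otimes>\<^bsub>AA_V\<^esub> v) = tmap AV A_AV id (\<lambda>w. q \<otimes>\<^bsub>AV\<^esub> w) (lam (p \<otimes>\<^bsub>AV\<^esub> v))"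
  unfolding V3.assoc by (rule leg13_tensor[OF V3.VW V3.VW V3.U_VW linear_lam])

lemma lam_slice2_tensor:
  "lam_slice2 v (p \<otimes>\<^bsub>AA\<^esub> q) = tmap AV AA id (lam_slice q) (lam (p \<otimes>\<^bsub>AV\<^esub> v))"
proof -
  have l: "lin sV (tscale AV) (\<lambda>w. lam (q \<otimes>\<^bsub>AV\<^esub> w))"
    by (rule lin_compose[OF AV.lin_tensor_right linear_lam])
  have "lam_slice2 v (p \<otimes>\<^bsub>AA\<^esub> q) = tmap A_AV AA id (rslice sA AV \<theta>)
      (tmap AV A_AV id (\<lambda>w. lam (q \<otimes>\<^bsub>AV\<^esub> w)) (lam (p \<otimes>\<^bsub>AV\<^esub> v)))"
    unfolding lam_slice2_def slice3 leg13_lam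
      tmap_tmap[OF V3.VW V3.U_VW V3.U_VW lin_id_A(1) AV.lin_tensor_right lin_id_A(1) linear_lam]
    by (simp add: id_def)
  also have "\<dots> = tmap AV AA id (lam_slice q) (lam (p \<otimes>\<^bsub>AV\<^esub> v))"
    unfolding tmap_tmap[OF V3.VW V3.U_VW A3.UV lin_id_A(1) l lin_id_A(1) lin_slice]
    by (simp add: id_def lam_slice_def[abs_def])
  finally show ?thesis .
qed

lemma lam_slice2_E1: "lam_slice2 v (E1 t) = lam_slice2 v t"
proof -
  have "E1 t \<otimes>\<^bsub>AA_V\<^esub> v = tmap AA_V AA_V E1 id (t \<otimes>\<^bsub>AA_V\<^esub> v)"
    by (simp add: tmap_tensor[OF V3.UV_W V3.UV_W lin_structure(1) lin_id_V])
  then show ?thesis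
    unfolding lam_slice2_def using lam_E1 by (metis comp_apply)
qed

text \<open>
  The slice by \<open>\<theta>\<close> of the coassociativity of the coaction: both sides are
  \<open>v\<^sub>-\<^sub>2 p\<^sub>1 \<otimes> v\<^sub>-\<^sub>1 p\<^sub>2 q \<theta>(v\<^sub>0)\<close>.
\<close>

lemma lam_slice2_T1: "lam_slice2 v (T1 (p \<otimes>\<^bsub>AA\<^esub> q)) = T1 (lam_slice p v \<otimes>\<^bsub>AA\<^esub> q)"
proof -
  let ?k = "rslice (tscale AA) AA_V \<theta>" and ?l = "leg13 AV AV A_AV lam"
  have "T1 (p \<otimes>\<^bsub>AA\<^esub> q) \<otimes>\<^bsub>AA_V\<^esub> v = tmap AA_V AA_V T1 id ((p \<otimes>\<^bsub>AA\<^esub> q) \<otimes>\<^bsub>AA_V\<^esub> v)"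
    by (simp add: tmap_tensor[OF V3.UV_W V3.UV_W lin_structure(3) lin_id_V])
  then have "lam_slice2 v (T1 (p \<otimes>\<^bsub>AA\<^esub> q)) = ?k (tmap AA_V AA_V T1 id (?l ((p \<otimes>\<^bsub>AA\<^esub> q) \<otimes>\<^bsub>AA_V\<^esub> v)))"
    unfolding lam_slice2_def using lam_T1 by (metis comp_apply)
  also have "\<dots> = T1 (?k (?l ((p \<otimes>\<^bsub>AA\<^esub> q) \<otimes>\<^bsub>AA_V\<^esub> v)))"
    by (simp add: rslice_tmap[OF V3.UV_W V3.UV_W lin_structure(3) lin_id_V linear_functional])
  also have "?k (?l ((p \<otimes>\<^bsub>AA\<^esub> q) \<otimes>\<^bsub>AA_V\<^esub> v)) = tmap AV AA id (\<lambda>w. rslice sA AV \<theta> (q \<otimes>\<^bsub>AV\<^esub> w)) (lam (p \<otimes>\<^bsub>AV\<^esub> v))"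
    unfolding slice3 leg13_lam
      tmap_tmap[OF V3.VW V3.U_VW A3.UV lin_id_A(1) AV.lin_tensor_right lin_id_A(1) lin_slice]
    by (simp add: id_def)
  also have "\<dots> = lam_slice p v \<otimes>\<^bsub>AA\<^esub> q"
    unfolding lam_slice_def
  proof (rule AV.tensor_ext[where t = "lam (p \<otimes>\<^bsub>AV\<^esub> v)" and g = "\<lambda>t. rslice sA AV \<theta> t \<otimes>\<^bsub>AA\<^esub> q"])
    have l: "lin sV sA (\<lambda>w. rslice sA AV \<theta> (q \<otimes>\<^bsub>AV\<^esub> w))"
      by (rule lin_compose[OF AV.lin_tensor_right lin_slice])
    show "lin (tscale AV) (tscale AA) (tmap AV AA id (\<lambda>w. rslice sA AV \<theta> (q \<otimes>\<^bsub>AV\<^esub> w)))"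
      by (rule lin_tmap[OF V3.VW A3.UV lin_id_A(1) l])
    show "lin (tscale AV) (tscale AA) (\<lambda>t. rslice sA AV \<theta> t \<otimes>\<^bsub>AA\<^esub> q)"
      by (rule lin_compose[OF lin_slice AA.lin_tensor_left])
    show "tmap AV AA id (\<lambda>w. rslice sA AV \<theta> (q \<otimes>\<^bsub>AV\<^esub> w)) (x \<otimes>\<^bsub>AV\<^esub> w) =
        rslice sA AV \<theta> (x \<otimes>\<^bsub>AV\<^esub> w) \<otimes>\<^bsub>AA\<^esub> q" for x w
      unfolding tmap_tensor[OF V3.VW A3.UV lin_id_A(1) l]
      by (simp add: AV.rslice_tensor linear_functional
          lin_scale[OF AA.lin_tensor_left] lin_scale[OF AA.lin_tensor_right])
  qed
  finally show ?thesis .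
qed

text \<open>
  Both sides are \<open>c b\<^sub>1 v\<^sub>-\<^sub>2 \<otimes> b\<^sub>2 v\<^sub>-\<^sub>1 \<theta>(v\<^sub>0)\<close>, multiplied by \<open>z\<close> from the right.
  Coassociativity of the coaction is available for \<open>z\<close> in the range of \<open>T1\<close>, and neither side
  changes when \<open>z\<close> is replaced by \<open>E1 z = T1(R1 z)\<close>.
\<close>

lemma T2_rho_slice:
  assumes TR: "T1 \<circ> R1 = E1"
  shows "T2 (c \<otimes>\<^bsub>AA\<^esub> rho_slice b v) \<bullet> z = T2 (c \<otimes>\<^bsub>AA\<^esub> b) \<bullet> lam_slice2 v z"
proof -
  have T: "T2 (c \<otimes>\<^bsub>AA\<^esub> rho_slice b v) \<bullet> T1 s = T2 (c \<otimes>\<^bsub>AA\<^esub> b) \<bullet> lam_slice2 v (T1 s)" for s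
  proof (rule AA.tensor_ext[OF lin_compose[OF lin_structure(3) lin_tmult_right]
        lin_compose[OF lin_compose[OF lin_structure(3) lin_lam_slice2] lin_tmult_right]])
    show "T2 (c \<otimes>\<^bsub>AA\<^esub> rho_slice b v) \<bullet> T1 (p \<otimes>\<^bsub>AA\<^esub> q) = T2 (c \<otimes>\<^bsub>AA\<^esub> b) \<bullet> lam_slice2 v (T1 (p \<otimes>\<^bsub>AA\<^esub> q))" for p q
      by (simp add: lam_slice2_T1 T2_tmult_T1 lam_slice_rho_slice)
  qed
  have "T2 (c \<otimes>\<^bsub>AA\<^esub> rho_slice b v) \<bullet> z = T2 (c \<otimes>\<^bsub>AA\<^esub> rho_slice b v) \<bullet> T1 (R1 z)"
    using TR T2_tmult_E1 by (metis comp_apply)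
  also have "\<dots> = T2 (c \<otimes>\<^bsub>AA\<^esub> b) \<bullet> lam_slice2 v (E1 z)"
    unfolding T using TR by (metis comp_apply)
  finally show ?thesis
    by (simp add: lam_slice2_E1)
qed

text \<open>
  The coideal property: \<open>T2(c \<otimes> rho_slice b v)\<close> is a sum of tensors whose second factors are
  again values of \<open>rho_slice\<close>, so any linear map that vanishes on these kills it.
\<close>

lemma T2_rho_slice_vanishes:
  assumes TR: "T1 \<circ> R1 = E1" and h: "lin sA sA h" and zero: "\<And>b v. h (rho_slice b v) = 0"
  shows "tmap AA AA id h (T2 (c \<otimes>\<^bsub>AA\<^esub> rho_slice b v)) = 0"
proof -
  \<comment> \<open>For \<open>u = c \<otimes> b\<close> the witness is \<open>c v\<^sub>-\<^sub>2 \<otimes> b v\<^sub>-\<^sub>1 \<theta>(v\<^sub>0)\<close>; the case needed is \<open>u = T2(c \<otimes> b)\<close>.\<close>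
  have "\<exists>w. (\<forall>z. u \<bullet> lam_slice2 v z = w \<bullet> z) \<and> tmap AA AA id h w = 0" for u
  proof (induct u rule: AA.tensor_induct)
    case (tensor c b)
    let ?w = "tmap AV AA id (rho_slice b) (rho (c \<otimes>\<^bsub>AV\<^esub> v))"
    have "(c \<otimes>\<^bsub>AA\<^esub> b) \<bullet> lam_slice2 v z = ?w \<bullet> z" for z
    proof (rule AA.tensor_ext[OF lin_compose[OF lin_lam_slice2 lin_tmult_right] lin_tmult_right])
      fix p q
      have bl: "lin sV sA (\<lambda>w. b * lam_slice q w)"
        by (rule lin_compose[OF lin_lam_slice(2) lin_mult_left])
      have "(c \<otimes>\<^bsub>AA\<^esub> b) \<bullet> lam_slice2 v (p \<otimes>\<^bsub>AA\<^esub> q) =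
          tmap AV AA (\<lambda>x. c * x) (\<lambda>w. b * lam_slice q w) (lam (p \<otimes>\<^bsub>AV\<^esub> v))"
        unfolding tmult_tensor_left lam_slice2_tensor
        by (subst tmap_tmap[OF V3.VW A3.UV A3.UV]) simp_all
      also have "\<dots> = tmap AV AA id (\<lambda>w. b * lam_slice q w) (tmap AV AV ((*) c) id (lam (p \<otimes>\<^bsub>AV\<^esub> v)))"
        by (subst tmap_tmap[OF V3.VW V3.VW A3.UV]) (simp_all add: bl lin_id_V)
      also have "\<dots> = tmap AV AA id (\<lambda>w. b * lam_slice q w) (tmap AV AV (\<lambda>x. x * p) id (rho (c \<otimes>\<^bsub>AV\<^esub> v)))"
        by (simp add: lam_rho)
      also have "\<dots> = tmap AV AA (\<lambda>x. x * p) (\<lambda>w. rho_slice b w * q) (rho (c \<otimes>\<^bsub>AV\<^esub> v))"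
        by (subst tmap_tmap[OF V3.VW V3.VW A3.UV]) (simp_all add: bl lin_id_V lam_slice_rho_slice[symmetric])
      also have "\<dots> = ?w \<bullet> (p \<otimes>\<^bsub>AA\<^esub> q)"
        unfolding tmult_tensor_right
        by (subst tmap_tmap[OF V3.VW A3.UV A3.UV]) simp_all
      finally show "(c \<otimes>\<^bsub>AA\<^esub> b) \<bullet> lam_slice2 v (p \<otimes>\<^bsub>AA\<^esub> q) = ?w \<bullet> (p \<otimes>\<^bsub>AA\<^esub> q)" .
    qed
    moreover have "tmap AA AA id h ?w = 0"
    proof (rule AV.tensor_ext[where f = "\<lambda>t. tmap AA AA id h (tmap AV AA id (rho_slice b) t)" and g = "\<lambda>_. 0"])
      show "lin (tscale AV) (tscale AA) (\<lambda>t. tmap AA AA id h (tmap AV AA id (rho_slice b) t))"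
        by (rule lin_compose[OF lin_tmap[OF V3.VW A3.UV lin_id_A(1) lin_rho_slice(2)]
              lin_tmap_AA[OF lin_id_A(1) h]])
      show "lin (tscale AV) (tscale AA) (\<lambda>_. 0)"
        by (intro lin_0 AV.vector_space_tensor AA.vector_space_tensor)
      show "tmap AA AA id h (tmap AV AA id (rho_slice b) (x \<otimes>\<^bsub>AV\<^esub> y)) = 0" for x y
        by (simp add: tmap_tensor[OF V3.VW A3.UV lin_id_A(1) lin_rho_slice(2)] h zero
            lin_zero[OF AA.lin_tensor_right])
    qed
    ultimately show ?case by blast
  next
    case (add s t)
    then obtain w w' where "\<forall>z. s \<bullet> lam_slice2 v z = w \<bullet> z" "tmap AA AA id h w = 0"
      "\<forall>z. t \<bullet> lam_slice2 v z = w' \<bullet> z" "tmap AA AA id h w' = 0"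
      by blast
    then show ?case
      using lin_add[OF lin_tmap_AA[OF lin_id_A(1) h], of w w']
      by (intro exI[of _ "w + w'"]) (simp only: lin_add[OF lin_tmult_left] add_0_right simp_thms)
  qed
  then obtain w where w: "\<And>z. T2 (c \<otimes>\<^bsub>AA\<^esub> b) \<bullet> lam_slice2 v z = w \<bullet> z" "tmap AA AA id h w = 0"
    by blast
  have "T2 (c \<otimes>\<^bsub>AA\<^esub> rho_slice b v) = w"
    by (rule tmult_separates_left) (simp add: T2_rho_slice[OF TR] w)
  with w(2) show ?thesis by simp
qed

text \<open>
  It suffices to show \<open>R1(rho_slice b v \<otimes> d) = 0\<close>.  As \<open>A\<close> is idempotent, \<open>b\<close> and \<open>d\<close> may be
  taken to be products; then \<open>E1\<close> acts on the left factors of these products only, and what it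
  produces is again a sum of tensors \<open>rho_slice b v \<otimes> d\<close>, to which \<open>T2_rho_slice_vanishes\<close>
  applies.
\<close>

lemma rho_slice_eq_0:
  assumes full: "right_full sA AA T1" and S: "is_antipode sA AA E1 E2 T1 T2 T3 T4 \<epsilon> S"
    and zero: "\<And>b v a. lact (S (rho_slice b v)) a = 0"
  shows "rho_slice b v = 0"
proof -
  obtain G1 R1 where G1: "is_G1 sA AA E1 T1 T4 \<epsilon> G1" and R1: "lin (tscale AA) (tscale AA) R1"
    and RT: "R1 \<circ> T1 = G1" and TR: "T1 \<circ> R1 = E1" and RTR: "R1 \<circ> T1 \<circ> R1 = R1"
    and SR: "\<And>a b. lact (S a) b = lslice sA AA \<epsilon> (R1 (a \<otimes>\<^bsub>AA\<^esub> b))"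
    using S unfolding is_antipode_def by blast
  let ?\<sigma> = "\<lambda>s. lslice sA AA \<epsilon> (R1 s)"
  have lin_\<sigma>: "lin (tscale AA) sA ?\<sigma>"
    by (rule lin_compose[OF R1 lin_slices(1)])
  have lin_\<sigma>A: "lin (tscale A_AA) (tscale AA) (tmap A_AA AA id ?\<sigma>)"
    by (rule lin_tmap[OF A3.U_VW A3.UV lin_id_A(1) lin_\<sigma>])
  have "R1 (rho_slice (b' * b) v \<otimes>\<^bsub>AA\<^esub> (d' * d)) = 0" for b' b d' d
  proof (rule mult_left_separates[OF A3.UV])
    fix c
    let ?f = "\<lambda>t. tmap A_AA AA id ?\<sigma> (tmap AA_A AA_A T2 id
        (c \<otimes>\<^bsub>A_AA\<^esub> tmap AA AA (\<lambda>x. x * rho_slice b v) (\<lambda>y. y * d) t))"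
    have f: "?f t = 0" for t
    proof (rule AA.tensor_ext[where f = ?f and g = "\<lambda>_. 0"])
      show "lin (tscale AA) (tscale AA) ?f"
        by (rule lin_compose[OF lin_compose[OF lin_compose[OF lin_tmap_AA A_AA.lin_tensor_right] lin_T2_A]
              lin_\<sigma>A]) simp_all
      show "lin (tscale AA) (tscale AA) (\<lambda>_. 0)"
        by (intro lin_0 AA.vector_space_tensor)
      fix p q
      have "?f (p \<otimes>\<^bsub>AA\<^esub> q) = tmap A_AA AA id ?\<sigma> (T2 (c \<otimes>\<^bsub>AA\<^esub> rho_slice (p * b) v) \<otimes>\<^bsub>AA_A\<^esub> (q * d))"
        by (simp add: A3.assoc[symmetric] rho_slice_mult tmap_tensor[OF A3.UV_W A3.UV_W])
      also have "\<dots> = tmap AA AA id (\<lambda>y. lact (S y) (q * d)) (T2 (c \<otimes>\<^bsub>AA\<^esub> rho_slice (p * b) v))"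
        by (simp add: A3.tmap_assoc_right[OF A3.UV lin_id_A(1) lin_\<sigma>] SR)
      also have "\<dots> = 0"
      proof (rule T2_rho_slice_vanishes[OF TR])
        show "lact (S (rho_slice b v)) (q * d) = 0" for b v
          by (rule zero)
        show "lin sA sA (\<lambda>y. lact (S y) (q * d))"
          using S by (simp add: is_antipode_def linear_to_multipliers_def)
      qed
      finally show "?f (p \<otimes>\<^bsub>AA\<^esub> q) = 0" .
    qed
    have "E1 (rho_slice (b' * b) v \<otimes>\<^bsub>AA\<^esub> (d' * d)) =
        tmap AA AA (\<lambda>x. x * rho_slice b v) (\<lambda>y. y * d) (E1 (b' \<otimes>\<^bsub>AA\<^esub> d'))"
      by (simp add: E1_right_module[symmetric] rho_slice_mult)
    then show "tmap AA AA ((*) c) id (R1 (rho_slice (b' * b) v \<otimes>\<^bsub>AA\<^esub> (d' * d))) = 0"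
      by (simp add: R1_via_antipode[OF G1 R1 RT TR RTR] f)
  qed
  then have *: "R1 (rho_slice (b' * b) v \<otimes>\<^bsub>AA\<^esub> d) = 0" for b' b d
    by (rule linear_eq_on_products[OF lin_compose[OF AA.lin_tensor_right R1]
          lin_0[OF AA.vector_space_left AA.vector_space_tensor]])
  have "R1 (rho_slice b v \<otimes>\<^bsub>AA\<^esub> d) = 0" for b d
    by (rule linear_eq_on_products[OF lin_compose[OF lin_compose[OF lin_rho_slice(1) AA.lin_tensor_left] R1]
          lin_0[OF AA.vector_space_left AA.vector_space_tensor] *])
  then have "E1 (rho_slice b v \<otimes>\<^bsub>AA\<^esub> d) = 0" for d
    using TR lin_zero[OF lin_structure(3)] by (metis comp_apply)
  then show ?thesis
    by (rule E1_separates[OF full])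
qed

lemma lam_slice_eq_0:
  assumes "\<And>b v. rho_slice b v = 0"
  shows "lam_slice b v = 0"
  by (rule nondegenerate_left) (simp add: lam_slice_rho_slice assms)

end

section \<open>Fullness\<close>

theorem proposition6p5:
  fixes sA :: "'k::field \<Rightarrow> 'a::ring \<Rightarrow> 'a"
    and sV :: "'k \<Rightarrow> 'v::ab_group_add \<Rightarrow> 'v"
    and AA :: "('k, 'a, 'a, 'aa::ab_group_add) tensor_space"
    and AA_A :: "('k, 'aa, 'a, 'aaa::ab_group_add) tensor_space"
    and A_AA :: "('k, 'a, 'aa, 'aaa) tensor_space"
    and AV :: "('k, 'a, 'v, 'av::ab_group_add) tensor_space"
    and AA_V :: "('k, 'aa, 'v, 'aav::ab_group_add) tensor_space"
    and A_AV :: "('k, 'a, 'av, 'aav) tensor_space"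
    and VA :: "('k, 'v, 'a, 'va::ab_group_add) tensor_space"
    and VA_A :: "('k, 'va, 'a, 'vaa::ab_group_add) tensor_space"
    and V_AA :: "('k, 'v, 'aa, 'vaa) tensor_space"
    and E1 E2 T1 T2 T3 T4 :: "'aa \<Rightarrow> 'aa"
    and \<epsilon> :: "'a \<Rightarrow> 'k"
    and S :: "'a \<Rightarrow> 'a multiplier"
    and lam rho :: "'av \<Rightarrow> 'av"
    and lamS rhoS :: "'va \<Rightarrow> 'va"
  assumes "regular_weak_multiplier_bialgebra sA AA AA_A A_AA E1 E2 T1 T2 T3 T4 \<epsilon>"
    and "left_full sA AA T2"
    and "right_full sA AA T1"
    and "is_antipode sA AA E1 E2 T1 T2 T3 T4 \<epsilon> S"
    and "left_comodule sV sA AV AA AA_V A_AV E1 T1 lam rho"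
    and "left_comodule_full sV sA AV lam"
    and "right_comodule sV sA VA AA VA_A V_AA E1 T1 lamS rhoS"
    and "\<And>v a b. lamS (v \<otimes>\<^bsub>VA\<^esub> lact (S b) a) =
      tmap VA VA id (\<lambda>y. lact (S y) a) (leg21 AV VA rho (v \<otimes>\<^bsub>VA\<^esub> b))"
    and "\<And>v a b. rhoS (v \<otimes>\<^bsub>VA\<^esub> ract a (S b)) =
      tmap VA VA id (\<lambda>y. ract a (S y)) (leg21 AV VA lam (v \<otimes>\<^bsub>VA\<^esub> b))"
  shows "right_comodule_full sV sA VA lamS"
proof (rule ccontr)
  interpret bialgebra: regular_weak_multiplier_bialgebra sA AA AA_A A_AA E1 E2 T1 T2 T3 T4 \<epsilon>
    by (rule assms(1))
  interpret comodule: left_comodule sV sA AV AA AA_V A_AV E1 T1 lam rho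
    by (rule assms(5))
  interpret comodule_S: right_comodule sV sA VA AA VA_A V_AA E1 T1 lamS rhoS
    by (rule assms(7))
  have VA: "tensor_product sV sA VA" and AV: "tensor_product sA sV AV"
    using comodule_S.tensor3_V comodule.tensor3_V by (simp_all add: tensor3_def)
  interpret VA: tensor_product sV sA VA by (rule VA)
  interpret AV: tensor_product sA sV AV by (rule AV)
  interpret V: vector_space sV by (rule VA.vector_space_left)
  interpret P: vector_space_pair sV "(*) :: 'k \<Rightarrow> 'k \<Rightarrow> 'k"
    by (intro vector_space_pair.intro VA.vector_space_left vector_space_field)
  let ?slices = "{rslice sV VA \<omega> (lamS (v \<otimes>\<^bsub>VA\<^esub> a)) | v a \<omega>. lin sA (*) \<omega>}"
  assume "\<not> right_comodule_full sV sA VA lamS"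
  then obtain x where "x \<notin> V.span ?slices"
    unfolding right_comodule_full_def by blast
  then obtain \<theta> where \<theta>: "lin sV (*) \<theta>" "\<theta> x = 1" and \<theta>0: "\<forall>y\<in>?slices. \<theta> y = 0"
    by (rule linear_functional_separates[OF VA.vector_space_left])
  interpret left_comodule_slice sA sV AA AA_A A_AA AV AA_V A_AV E1 E2 T1 T2 T3 T4 \<epsilon> lam rho \<theta>
    by (intro left_comodule_slice.intro left_comodule_slice_axioms.intro assms(1,5) \<theta>(1))
  have lin_S: "lin sA sA (\<lambda>y. lact (S y) a)" for a
    using assms(4) by (simp add: is_antipode_def linear_to_multipliers_def)
  \<comment> \<open>The two slots of \<open>V \<otimes> A\<close> and \<open>A \<otimes> V\<close> are exchanged, so that \<open>\<theta>\<close> acts from the other side.\<close>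
  have flip_slice: "lslice sA VA \<theta> (flip AV VA t) = rslice sA AV \<theta> t" for t
  proof (rule AV.tensor_ext[OF lin_compose[OF lin_flip[OF AV VA] VA.lin_lslice[OF \<theta>(1)]] lin_slice])
    show "lslice sA VA \<theta> (flip AV VA (x \<otimes>\<^bsub>AV\<^esub> y)) = rslice sA AV \<theta> (x \<otimes>\<^bsub>AV\<^esub> y)" for x y
      by (simp add: flip_tensor[OF AV VA] VA.lslice_tensor AV.rslice_tensor \<theta>(1))
  qed
  have "lact (S (rho_slice b v)) a = 0" for b v a
  proof -
    have "lslice sA VA \<theta> (lamS (v \<otimes>\<^bsub>VA\<^esub> lact (S b) a)) = 0"
    proof (rule functionals_separate[OF VA.vector_space_right])
      fix \<omega> assume \<omega>: "lin sA (*) \<omega>"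
      then show "\<omega> (lslice sA VA \<theta> (lamS (v \<otimes>\<^bsub>VA\<^esub> lact (S b) a))) = 0"
        unfolding VA.rslice_lslice[OF \<theta>(1) \<omega>, symmetric] using \<theta>0 by blast
    qed
    then have "lslice sA VA \<theta> (tmap VA VA id (\<lambda>y. lact (S y) a) (flip AV VA (rho (b \<otimes>\<^bsub>AV\<^esub> v)))) = 0"
      by (simp add: assms(8) leg21_def flip_tensor[OF VA AV])
    then show ?thesis
      by (simp add: lslice_tmap[OF VA VA lin_id_V lin_S \<theta>(1)] flip_slice rho_slice_def)
  qed
  then have "rho_slice b v = 0" for b v
    by (rule rho_slice_eq_0[OF assms(3) assms(4)])
  then have lam0: "lam_slice b v = 0" for b v
    by (rule lam_slice_eq_0)
  have "\<theta> (lslice sV AV \<omega> (lam (a \<otimes>\<^bsub>AV\<^esub> v))) = 0" if \<omega>: "lin sA (*) \<omega>" for a v \<omega>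
    unfolding AV.rslice_lslice[OF \<omega> \<theta>(1), symmetric] lam_slice_def[symmetric] lam0
    by (rule lin_zero[OF \<omega>])
  then have "\<theta> y = 0" if "y \<in> V.span {lslice sV AV \<omega> (lam (a \<otimes>\<^bsub>AV\<^esub> v)) | v a \<omega>. lin sA (*) \<omega>}" for y
    by (intro P.linear_eq_0_on_span[OF \<theta>(1) _ that]) auto
  then have "\<theta> x = 0"
    using assms(6) unfolding left_comodule_full_def by simp
  with \<theta>(2) show False by simp
qed

end
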